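(* Let $m\ge 1$, let $\Omega\subset\mathbb{R}^m$ be a convex open cone and let $\frac{\partial W}{\partial t}+\frac{\partial}{\partial x}F(W)=0$ be a strictly hyperbolic system of conservation laws with values in $\Omega$, all of whose characteristic fields are either genuinely nonlinear or linearly degenerate. Let $0\le p\le m$, let $W_0\in\Omega$, let $\Omega_0\subset\Omega$ be a neighbourhood of $W_0$, let $\Theta\subset\mathbb{R}^m$ be a neighbourhood of $0$, and let $\Phi:\Omega_0\to\Theta$ be a bijection of class $\mathcal{C}^1$ with $\Phi^{-1}$ of class $\mathcal{C}^1$. Let $$\mathcal{M}_r=\{X\in\Omega_0:\ \Phi_1(X)=\cdots=\Phi_p(X)=0\},$$ and assume $W_0\in\mathcal{M}_r$. For $k=p+1,\dots,m$ let $\xi_k(W_0)$ be the tangent vector to $\mathcal{M}_r$ at $W_0$ defined by $\mathrm{d}\Phi(W_0)\cdot\xi_k(W_0)=e_k$, where $(e_1,\dots,e_m)$ is the canonical basis of $\mathbb{R}^m$. Assume (transversality) that the family $$\bigl(R_1(W_0),\dots,R_p(W_0),\xi_{p+1}(W_0),\dots,\xi_m(W_0)\bigr)$$ is a basis of $\mathbb{R}^m$, where $R_j(W_0)$ is the $j$-th eigenvector of $\mathrm{d}F(W_0)$. Then there exists a neighbourhood $\Omega_1\subset\Omega_0$ of $W_0$ such that for every $W_l\in\Omega_1$ the partial Riemann problem $P(W_l,\mathcal{M}_r)$, that is, the Cauchy problem for the system of conservation laws with initial constraints $$W(x,0)=W_l\ \text{ for } x<0,\qquad W(x,0)\in\mathcal{M}_r\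 \text{ for } x>0,$$ has an entropy solution with values in $\Omega$ composed of at most $p+1$ constant states $$W^0=W_l,\quad W^1=\chi_1(\epsilon_1;W^0),\ \dots,\ W^{p-1}=\chi_{p-1}(\epsilon_{p-1};W^{p-2}),\quad W^p=\chi_p(\epsilon_p;W^{p-1}),\qquad W^p\in\mathcal{M}_r,$$ separated by at most $p$ simple waves. In space-time, this solution $(x,t)\in\mathbb{R}\times]0,+\infty[\ \mapsto U(\tfrac{x}{t};W_l,\mathcal{M}_r)$ is obtained by superposition of these $p$ simple waves: with $\mu_j^-$ and $\mu_j^+$ the smallest and largest celerities of the $j$-th wave (between $W^{j-1}$ and $W^j$), $$U(\xi;W_l,\mathcal{M}_r)=\begin{cases}W^0=W_l, & \xi<\mu_1^-,\\ \quad\vdots\\ \chi_j(\xi-\mu_j^-;W^{j-1}), & \mu_j^-<\xi<\mu_j^+,\\ W^j, & \mu_j^+<\xi<\mu_{j+1}^-,\\ \quad\vdots\\ W^p\in\mathcal{M}_r, & \xi>\mu_p^+.\end{cases}$$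
   Context: Setting. $\Omega\subset\mathbb{R}^m$ is a convex open cone ($\lambda W\in\Omega$ for all $W\in\Omega$, $\lambda>0$). The flux $F:\Omega\to\mathbb{R}^m$ is sufficiently regular (typically of class $\mathcal{C}^2$). Strict hyperbolicity: for each $W\in\Omega$ the Jacobian $\mathrm{d}F(W)$ has $m$ distinct real eigenvalues $\lambda_1(W)<\cdots<\lambda_m(W)$ with eigenvectors $R_j(W)\in\mathbb{R}^m$: $\mathrm{d}F(W)\cdot R_j(W)=\lambda_j(W)R_j(W)$. The $j$-th field is genuinely nonlinear if (after normalization) $\mathrm{d}\lambda_j(W)\cdot R_j(W)=1$ for all $W\in\Omega$, and linearly degenerate if $\mathrm{d}\lambda_j(W)\cdot R_j(W)=0$ for all $W\in\Omega$. Simple waves. For each $j$ and each state $W_*\in\Omega$ there is (classical fact, taken as given) a regular ($\mathcal{C}^2$) $j$-wave curve $\epsilon\mapsto\chi_j(\epsilon;W_* )\in\Omega$, defined for $\epsilon$ in a neighbourhood $\Theta_j$ of $0$ in $\mathbb{R}$, and also depending regularly on $W_*$ (the map $(\epsilon,W_* )\mapsto\chi_j(\epsilon;W_* )$ is regular), with $\chi_j(\epsilon;W_* )=W_*+\epsilon R_j(W_* )+O(\epsilon^2)$, as follows. - $j$-rarefaction ($j$-th field genuinely nonlinear, $\epsilon>0$): $\frac{\partial}{\partial\epsilon}\chi_j(\epsilon;W_* )=R_j(\chi_j(\epsilon;W_* ))$, $\chi_j(0;W_* )=W_*$. In space-time it joins $W_*$ to $\chi_j(\epsilon;W_* )$ by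 $W(x,t)=W_*$ for $\frac{x}{t}<\lambda_j(W_* )$, $W(x,t)=\chi_j(\frac{x}{t}-\lambda_j(W_* );W_* )$ for $\lambda_j(W_* )\le\frac{x}{t}\le\lambda_j(\chi_j(\epsilon;W_* ))$, and $W(x,t)=\chi_j(\epsilon;W_* )$ for larger $\frac{x}{t}$. - $j$-shock ($j$-th field genuinely nonlinear, $\epsilon<0$): there is a celerity $\sigma_j(\epsilon;W_* )$ with the Rankine-Hugoniot relation $F(\chi_j(\epsilon;W_* ))-F(W_* )=\sigma_j(\epsilon;W_* )\,(\chi_j(\epsilon;W_* )-W_* )$ and the Lax entropy condition $\lambda_j(\chi_j(\epsilon;W_* ))<\sigma_j(\epsilon;W_* )<\lambda_j(W_* )$. In space-time it is the discontinuity equal to $W_*$ for $\frac{x}{t}<\sigma_j$ and to $\chi_j(\epsilon;W_* )$ for $\frac{x}{t}>\sigma_j$. - $j$-contact discontinuity ($j$-th field linearly degenerate, $\epsilon$ of any sign): $\chi_j$ is the integral curve of $R_j$ issued from $W_*$; $\lambda_j$ is constant on it, and in space-time the wave is the discontinuity equal to $W_*$ for $\frac{x}{t}<\lambda_j(W_* )$ and to $\chi_j(\epsilon;W_* )$ for $\frac{x}{t}>\lambda_j(W_* )$. Celerities. For the $j$-th wave from $W^{j-1}$ to $W^j=\chi_j(\epsilon_j;W^{j-1})$: $\mu_j^-=\lambda_j(W^{j-1})$ and $\mu_j^+=\lambda_j(W^j)$ for a rarefaction; $\mu_j^-=\mu_j^+=$ the celerity of the discontinuity for a shock or a contact discontinuity.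 An entropy solution here means a self-similar weak solution of the system, composed of constant states, rarefactions, contact discontinuities and shocks satisfying the Lax entropy condition. *)

theory Defs
  imports "HOL-Analysis.Analysis"
begin

text \<open>Classes \<open>C\<^sup>1\<close> and \<open>C\<^sup>2\<close>; only used on open sets.\<close>

definition C1_on :: "('a::real_normed_vector \<Rightarrow> 'b::real_normed_vector) \<Rightarrow> 'a set \<Rightarrow> bool" where
  "C1_on f S \<longleftrightarrow> (\<exists>f'. (\<forall>x\<in>S. (f has_derivative blinfun_apply (f' x)) (at x)) \<and> continuous_on S f')"

definition C2_on :: "('a::real_normed_vector \<Rightarrow> 'b::real_normed_vector) \<Rightarrow> 'a set \<Rightarrow> bool" where
  "C2_on f S \<longleftrightarrow> (\<exists>f'. (\<forall>x\<in>S. (f has_derivative blinfun_apply (f' x)) (at x)) \<and> C1_on f' S)"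

text \<open>The library's \<open>cone\<close> requires stability under multiplication by 0 as well, which would force
  a nonempty open cone to be the whole space.\<close>

definition convex_open_cone :: "'a::real_normed_vector set \<Rightarrow> bool" where
  "convex_open_cone Om \<longleftrightarrow> convex Om \<and> open Om \<and> (\<forall>W\<in>Om. \<forall>c>0. c *\<^sub>R W \<in> Om)"

text \<open>Characteristic fields are numbered by the natural numbers from 1 to \<open>m = CARD('m)\<close>.\<close>

definition strictly_hyperbolic ::
  "(real^'m \<Rightarrow> real^'m) \<Rightarrow> (real^'m) set \<Rightarrow> (nat \<Rightarrow> real^'m \<Rightarrow> real) \<Rightarrow>
   (nat \<Rightarrow> real^'m \<Rightarrow> real^'m) \<Rightarrow> bool" where
  "strictly_hyperbolic F Om lam R \<longleftrightarrow>
     (\<forall>W\<in>Om.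
        (\<forall>j\<in>{1..CARD('m)}. R j W \<noteq> 0 \<and>
            frechet_derivative F (at W) (R j W) = lam j W *\<^sub>R R j W) \<and>
        (\<forall>i\<in>{1..CARD('m)}. \<forall>j\<in>{1..CARD('m)}. i < j \<longrightarrow> lam i W < lam j W))"

definition genuinely_nonlinear ::
  "(real^'m) set \<Rightarrow> (nat \<Rightarrow> real^'m \<Rightarrow> real) \<Rightarrow> (nat \<Rightarrow> real^'m \<Rightarrow> real^'m) \<Rightarrow> nat \<Rightarrow> bool" where
  "genuinely_nonlinear Om lam R j \<longleftrightarrow>
     (\<forall>W\<in>Om. lam j differentiable at W \<and> frechet_derivative (lam j) (at W) (R j W) = 1)"

definition linearly_degenerate ::
  "(real^'m) set \<Rightarrow> (nat \<Rightarrow> real^'m \<Rightarrow> real) \<Rightarrow> (nat \<Rightarrow> real^'m \<Rightarrow> real^'m) \<Rightarrow> nat \<Rightarrow> bool" where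
  "linearly_degenerate Om lam R j \<longleftrightarrow>
     (\<forall>W\<in>Om. lam j differentiable at W \<and> frechet_derivative (lam j) (at W) (R j W) = 0)"

text \<open>A discontinuity of celerity \<open>s\<close> from the left state \<open>a\<close> to the right state \<open>b\<close>:
  Rankine-Hugoniot relation and Lax entropy condition.\<close>

definition lax_shock ::
  "(real^'m \<Rightarrow> real^'m) \<Rightarrow> (nat \<Rightarrow> real^'m \<Rightarrow> real) \<Rightarrow> nat \<Rightarrow> real \<Rightarrow> real^'m \<Rightarrow> real^'m \<Rightarrow> bool" where
  "lax_shock F lam j s a b \<longleftrightarrow>
     F b - F a = s *\<^sub>R (b - a) \<and> lam j b < s \<and> s < lam j a"

definition contact_discontinuity ::
  "(real^'m \<Rightarrow> real^'m) \<Rightarrow> (real^'m) set \<Rightarrow> (nat \<Rightarrow> real^'m \<Rightarrow> real) \<Rightarrow>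
   (nat \<Rightarrow> real^'m \<Rightarrow> real^'m) \<Rightarrow> nat \<Rightarrow> real \<Rightarrow> real^'m \<Rightarrow> real^'m \<Rightarrow> bool" where
  "contact_discontinuity F Om lam R j s a b \<longleftrightarrow>
     F b - F a = s *\<^sub>R (b - a) \<and>
     (\<exists>c e. c 0 = a \<and> c e = b \<and>
        (\<forall>\<tau>\<in>closed_segment 0 e. c \<tau> \<in> Om \<and> lam j (c \<tau>) = s \<and>
           (c has_vector_derivative R j (c \<tau>)) (at \<tau> within closed_segment 0 e)))"

text \<open>\<open>chi \<epsilon> W\<close> is the \<open>j\<close>-wave curve issued from \<open>W\<close>, defined for \<open>\<epsilon>\<close> in the neighbourhood
  \<open>Th W\<close> of 0, and \<open>sig \<epsilon> W\<close> is the celerity of the \<open>j\<close>-shock (\<open>\<epsilon> < 0\<close>). The neighbourhood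
  may depend on \<open>W\<close>; \<open>Th W\<close> constant is the special case of a uniform one.\<close>

definition wave_curve ::
  "(real^'m \<Rightarrow> real^'m) \<Rightarrow> (real^'m) set \<Rightarrow> (nat \<Rightarrow> real^'m \<Rightarrow> real) \<Rightarrow>
   (nat \<Rightarrow> real^'m \<Rightarrow> real^'m) \<Rightarrow> nat \<Rightarrow> (real^'m \<Rightarrow> real set) \<Rightarrow>
   (real \<Rightarrow> real^'m \<Rightarrow> real^'m) \<Rightarrow> (real \<Rightarrow> real^'m \<Rightarrow> real) \<Rightarrow> bool" where
  "wave_curve F Om lam R j Th chi sig \<longleftrightarrow>
     open {(\<epsilon>, W). W \<in> Om \<and> \<epsilon> \<in> Th W} \<and>
     C1_on (\<lambda>(\<epsilon>, W). chi \<epsilon> W) {(\<epsilon>, W). W \<in> Om \<and> \<epsilon> \<in> Th W} \<and>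
     (\<forall>W\<in>Om.
        0 \<in> Th W \<and> C2_on (\<lambda>\<epsilon>. chi \<epsilon> W) (Th W) \<and> chi 0 W = W \<and>
        (\<exists>C. \<forall>\<^sub>F \<epsilon> in at 0. norm (chi \<epsilon> W - (W + \<epsilon> *\<^sub>R R j W)) \<le> C * \<epsilon>\<^sup>2) \<and>
        (\<forall>\<epsilon>\<in>Th W.
           chi \<epsilon> W \<in> Om \<and>
           (genuinely_nonlinear Om lam R j \<longrightarrow>
              (\<epsilon> > 0 \<longrightarrow> ((\<lambda>e. chi e W) has_vector_derivative R j (chi \<epsilon> W)) (at \<epsilon>)) \<and>
              (\<epsilon> < 0 \<longrightarrow> lax_shock F lam j (sig \<epsilon> W) W (chi \<epsilon> W))) \<and>
           (linearly_degenerate Om lam R j \<longrightarrow>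
              ((\<lambda>e. chi e W) has_vector_derivative R j (chi \<epsilon> W)) (at \<epsilon>))))"

text \<open>Smallest and largest celerities of the \<open>j\<close>-wave of strength \<open>\<epsilon>\<close> issued from \<open>W\<close>. For
  \<open>\<epsilon> = 0\<close> (no wave) both equal \<open>lam j W\<close>.\<close>

definition celerity_min ::
  "(real^'m) set \<Rightarrow> (nat \<Rightarrow> real^'m \<Rightarrow> real) \<Rightarrow> (nat \<Rightarrow> real^'m \<Rightarrow> real^'m) \<Rightarrow>
   (nat \<Rightarrow> real \<Rightarrow> real^'m \<Rightarrow> real) \<Rightarrow> nat \<Rightarrow> real \<Rightarrow> real^'m \<Rightarrow> real" where
  "celerity_min Om lam R sig j \<epsilon> W =
     (if genuinely_nonlinear Om lam R j \<and> \<epsilon> < 0 then sig j \<epsilon> W else lam j W)"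

definition celerity_max ::
  "(real^'m) set \<Rightarrow> (nat \<Rightarrow> real^'m \<Rightarrow> real) \<Rightarrow> (nat \<Rightarrow> real^'m \<Rightarrow> real^'m) \<Rightarrow>
   (nat \<Rightarrow> real \<Rightarrow> real^'m \<Rightarrow> real^'m) \<Rightarrow> (nat \<Rightarrow> real \<Rightarrow> real^'m \<Rightarrow> real) \<Rightarrow>
   nat \<Rightarrow> real \<Rightarrow> real^'m \<Rightarrow> real" where
  "celerity_max Om lam R chi sig j \<epsilon> W =
     (if genuinely_nonlinear Om lam R j
      then (if \<epsilon> < 0 then sig j \<epsilon> W else lam j (chi j \<epsilon> W))
      else lam j W)"

text \<open>Weak solutions on \<open>t > 0\<close> of the Cauchy problem with datum \<open>u0\<close>. Test functions are
  defined on the whole plane, so that they need not vanish at \<open>t = 0\<close>.\<close>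

definition test_function :: "(real \<times> real \<Rightarrow> real) \<Rightarrow> bool" where
  "test_function \<phi> \<longleftrightarrow> C1_on \<phi> UNIV \<and> compact (closure {z. \<phi> z \<noteq> 0})"

definition weak_solution ::
  "(real^'m \<Rightarrow> real^'m) \<Rightarrow> (real^'m) set \<Rightarrow> (real \<Rightarrow> real^'m) \<Rightarrow> (real \<Rightarrow> real \<Rightarrow> real^'m) \<Rightarrow> bool" where
  "weak_solution F Om u0 u \<longleftrightarrow>
     (\<forall>x. \<forall>t>0. u x t \<in> Om) \<and>
     (\<forall>K. compact K \<longrightarrow>
        set_integrable lborel (K \<inter> UNIV \<times> {0<..}) (\<lambda>(x, t). u x t) \<and>
        set_integrable lborel (K \<inter> UNIV \<times> {0<..}) (\<lambda>(x, t). F (u x t))) \<and>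
     (\<forall>K. compact K \<longrightarrow> set_integrable lborel K u0) \<and>
     (\<forall>\<phi>. test_function \<phi> \<longrightarrow>
        (LINT z:UNIV \<times> {0<..}|lborel.
           frechet_derivative \<phi> (at z) (0, 1) *\<^sub>R u (fst z) (snd z) +
           frechet_derivative \<phi> (at z) (1, 0) *\<^sub>R F (u (fst z) (snd z)))
        + (LINT x|lborel. \<phi> (x, 0) *\<^sub>R u0 x) = 0)"

text \<open>A self-similar function \<open>(x, t) \<mapsto> U (x / t)\<close> composed of finitely many constant states,
  rarefactions, shocks satisfying the Lax condition, and contact discontinuities. The finite set
  \<open>S\<close> contains the celerities at which the wave pattern changes; at a point of \<open>S\<close> with equal
  one-sided limits there is no discontinuity (edge of a rarefaction).\<close>

definition composed_of_waves ::
  "(real^'m \<Rightarrow> real^'m) \<Rightarrow> (real^'m) set \<Rightarrow> (nat \<Rightarrow> real^'m \<Rightarrow> real) \<Rightarrow>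
   (nat \<Rightarrow> real^'m \<Rightarrow> real^'m) \<Rightarrow> (real \<Rightarrow> real^'m) \<Rightarrow> bool" where
  "composed_of_waves F Om lam R U \<longleftrightarrow>
     (\<forall>\<xi>. U \<xi> \<in> Om) \<and>
     (\<exists>S. finite S \<and>
        (\<forall>I\<in>components (- S).
           U constant_on I \<or>
           (\<exists>j\<in>{1..CARD('m)}. genuinely_nonlinear Om lam R j \<and>
              (\<forall>\<xi>\<in>I. lam j (U \<xi>) = \<xi> \<and> (U has_vector_derivative R j (U \<xi>)) (at \<xi>)))) \<and>
        (\<forall>s\<in>S. \<exists>a\<in>Om. \<exists>b\<in>Om. (U \<longlongrightarrow> a) (at_left s) \<and> (U \<longlongrightarrow> b) (at_right s) \<and>
           (a = b \<or>
            (\<exists>j\<in>{1..CARD('m)}.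
               genuinely_nonlinear Om lam R j \<and> lax_shock F lam j s a b \<or>
               linearly_degenerate Om lam R j \<and> contact_discontinuity F Om lam R j s a b))))"

definition entropy_solution ::
  "(real^'m \<Rightarrow> real^'m) \<Rightarrow> (real^'m) set \<Rightarrow> (nat \<Rightarrow> real^'m \<Rightarrow> real) \<Rightarrow>
   (nat \<Rightarrow> real^'m \<Rightarrow> real^'m) \<Rightarrow> (real \<Rightarrow> real^'m) \<Rightarrow> (real \<Rightarrow> real^'m) \<Rightarrow> bool" where
  "entropy_solution F Om lam R u0 U \<longleftrightarrow>
     weak_solution F Om u0 (\<lambda>x t. U (x / t)) \<and> composed_of_waves F Om lam R U"

definition solves_partial_riemann ::
  "(real^'m \<Rightarrow> real^'m) \<Rightarrow> (real^'m) set \<Rightarrow> (nat \<Rightarrow> real^'m \<Rightarrow> real) \<Rightarrow>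
   (nat \<Rightarrow> real^'m \<Rightarrow> real^'m) \<Rightarrow> real^'m \<Rightarrow> (real^'m) set \<Rightarrow> (real \<Rightarrow> real^'m) \<Rightarrow> bool" where
  "solves_partial_riemann F Om lam R Wl M U \<longleftrightarrow>
     (\<exists>u0. (\<forall>x<0. u0 x = Wl) \<and> (\<forall>x>0. u0 x \<in> M) \<and> entropy_solution F Om lam R u0 U)"

text \<open>\<open>U\<close> is the superposition of \<open>p\<close> waves, the \<open>j\<close>-th one going from \<open>W (j - 1)\<close> to \<open>W j\<close>
  with celerities between \<open>mum j\<close> and \<open>mup j\<close>. The guards amount to the convention
  \<open>mup 0 = -\<infinity>\<close>, \<open>mum (p + 1) = +\<infinity>\<close>.\<close>

definition superposition ::
  "nat \<Rightarrow> (nat \<Rightarrow> real \<Rightarrow> real^'m \<Rightarrow> real^'m) \<Rightarrow> (nat \<Rightarrow> real) \<Rightarrow> (nat \<Rightarrow> real) \<Rightarrow>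
   (nat \<Rightarrow> real^'m) \<Rightarrow> (real \<Rightarrow> real^'m) \<Rightarrow> bool" where
  "superposition p chi mum mup W U \<longleftrightarrow>
     (\<forall>j\<in>{1..p}. mum j \<le> mup j) \<and>
     (\<forall>j. 1 \<le> j \<and> j < p \<longrightarrow> mup j < mum (Suc j)) \<and>
     (\<forall>j\<in>{0..p}. \<forall>\<xi>. (1 \<le> j \<longrightarrow> mup j < \<xi>) \<and> (j < p \<longrightarrow> \<xi> < mum (Suc j)) \<longrightarrow> U \<xi> = W j) \<and>
     (\<forall>j\<in>{1..p}. \<forall>\<xi>. mum j < \<xi> \<and> \<xi> < mup j \<longrightarrow> U \<xi> = chi j (\<xi> - mum j) (W (j - 1)))"

definition basis_family :: "nat \<Rightarrow> (nat \<Rightarrow> real^'m) \<Rightarrow> bool" where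
  "basis_family n B \<longleftrightarrow>
     inj_on B {1..n} \<and> independent (B ` {1..n}) \<and> span (B ` {1..n}) = UNIV"

text \<open>The enumeration \<open>ix\<close> of the index type by \<open>1, \<dots>, m\<close> gives meaning to the first \<open>p\<close>
  components.\<close>

definition constraint_manifold ::
  "(nat \<Rightarrow> 'm) \<Rightarrow> nat \<Rightarrow> (real^'m) set \<Rightarrow> (real^'m \<Rightarrow> real^'m) \<Rightarrow> (real^'m) set" where
  "constraint_manifold ix p Om0 \<Phi> = {X\<in>Om0. \<forall>i\<in>{1..p}. \<Phi> X $ ix i = 0}"

end

theory Submission
  imports Defs
begin

text \<open>
  The strengths \<open>\<epsilon>\<^sub>1, \<dots>, \<epsilon>\<^sub>p\<close> are found by an implicit function argument. Following the first \<open>p\<close> wave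
  curves from the left state gives a state depending on the strengths and on the left state; at
  strengths 0 and left state \<open>W\<^sub>0\<close> it equals \<open>W\<^sub>0\<close>, and its derivative in the strengths is
  \<open>e \<mapsto> \<Sum>\<^sub>j e\<^sub>j R\<^sub>j(W\<^sub>0)\<close> (\<open>wave_chain_at_base_state\<close>). Composing with \<open>\<Phi>\<^sub>1, \<dots>, \<Phi>\<^sub>p\<close> yields \<open>p\<close> equations
  for \<open>p\<close> unknowns, and transversality says precisely that their linearisation is injective
  (\<open>transversal_injective\<close>). So for every left state close to \<open>W\<^sub>0\<close> there are small strengths for which
  the last state lies on the manifold (\<open>implicit_solution\<close>); this is existence only,
  for which an open mapping theorem suffices.

  All states then lie close to \<open>W\<^sub>0\<close>. Since the celerities of a \<open>j\<close>-wave lie between the values of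
  \<open>\<lambda>\<^sub>j\<close> at its two ends (\<open>celerity_bounds\<close>) and the eigenvalues are distinct at \<open>W\<^sub>0\<close>, the waves are
  strictly ordered in the variable \<open>x/t\<close> and can be put side by side (\<open>superposition_of_waves\<close>).

  The result is a weak solution for a reason that has nothing to do with its construction
  (\<open>composed_of_waves_imp_entropy_solution\<close>): for a self-similar function the conservation law
  becomes \<open>(F(U) - \<xi> U)' = - U\<close> in \<open>\<xi> = x/t\<close>. It holds on constant states and on rarefactions by the
  eigenvector relation, and across discontinuities the Rankine-Hugoniot relation makes \<open>F(U) - \<xi> U\<close>
  continuous. Integrating against a test function on \<open>t > \<delta>\<close> in the variables \<open>(\<xi>, t)\<close>, by parts in \<open>\<xi>\<close>
  and along rays in \<open>t\<close>, leaves only the boundary term at \<open>t = \<delta>\<close>, which tends to the initial datum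
  (\<open>weak_identity\<close>).
\<close>

section \<open>Self-similar weak solutions\<close>

lemma integrable_lborel_bounded_support:
  fixes f :: "'a::euclidean_space \<Rightarrow> 'b::euclidean_space"
  assumes "f \<in> borel_measurable borel" "compact K"
    and "\<And>x. x \<in> K \<Longrightarrow> norm (f x) \<le> B" "\<And>x. x \<notin> K \<Longrightarrow> f x = 0"
  shows "integrable lborel f"
proof (rule integrableI_bounded_set[where A = K and B = B])
  show "emeasure lborel K < \<infinity>" using assms(2) by (rule emeasure_compact_finite)
qed (use assms in \<open>auto simp: borel_compact\<close>)

lemma continuous_image_norm_bound:
  fixes f :: "'a::topological_space \<Rightarrow> 'b::real_normed_vector"
  assumes "continuous_on K f" "compact K"
  obtains B where "0 < B" "\<And>x. x \<in> K \<Longrightarrow> norm (f x) \<le> B"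
  using compact_imp_bounded[OF compact_continuous_image[OF assms]] 
  unfolding bounded_pos by auto

text \<open>Suppose that \<open>U(x/t)\<close> solves \<open>u\<^sub>t + g\<^sub>x = 0\<close> with flux \<open>g = G(x/t)\<close>. In the variable
  \<open>\<xi> = x/t\<close> the equation reads \<open>(G - \<xi> U)' = - U\<close>: the quantity \<open>H = G - \<xi> U\<close> is continuous also
  where \<open>U\<close> jumps (this is the Rankine-Hugoniot relation), and it is a primitive of \<open>- U\<close>. The
  exceptional set \<open>S\<close> contains the celerities of the jumps; the values of \<open>G\<close> and \<open>U\<close> there are unrelated, so
  \<open>H\<close> is kept as a separate function that is continuous everywhere.\<close>

locale self_similar_pattern =
  fixes U G H :: "real \<Rightarrow> 'b::euclidean_space" and S :: "real set" and B :: real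
  assumes U_measurable [measurable]: "U \<in> borel_measurable borel"
    and G_measurable [measurable]: "G \<in> borel_measurable borel"
    and U_bound: "\<And>\<xi>. norm (U \<xi>) \<le> B"
    and G_bound: "\<And>\<xi>. norm (G \<xi>) \<le> B"
    and H_continuous: "continuous_on UNIV H"
    and S_finite: "finite S"
    and H_eq: "\<And>\<xi>. \<xi> \<notin> S \<Longrightarrow> H \<xi> = G \<xi> - \<xi> *\<^sub>R U \<xi>"
    and H_deriv: "\<And>\<xi>. \<xi> \<notin> S \<Longrightarrow> (H has_vector_derivative - U \<xi>) (at \<xi>)"

text \<open>The test function \<open>\<phi>\<close> is given with its two partial derivatives, and \<open>T\<close> bounds the support of
  all three.\<close>

locale plane_test_function =
  fixes \<phi> px pt :: "real \<times> real \<Rightarrow> real" and T :: real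
  assumes phi_deriv: "\<And>z. (\<phi> has_derivative (\<lambda>h. fst h * px z + snd h * pt z)) (at z)"
    and px_cont: "continuous_on UNIV px" and pt_cont: "continuous_on UNIV pt"
    and T_pos: "0 < T"
    and support: "\<And>z. T \<le> \<bar>fst z\<bar> \<or> T \<le> \<bar>snd z\<bar> \<Longrightarrow> \<phi> z = 0 \<and> px z = 0 \<and> pt z = 0"
begin

lemma phi_cont: "continuous_on UNIV \<phi>"
  using phi_deriv by (meson continuous_at_imp_continuous_on has_derivative_continuous)

lemma measurable_test [measurable]:
  "\<phi> \<in> borel_measurable borel" "px \<in> borel_measurable borel" "pt \<in> borel_measurable borel"
  using phi_cont px_cont pt_cont by (auto intro: borel_measurable_continuous_onI)

lemma continuous_test [continuous_intros]:
  assumes "continuous_on A f"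
  shows "continuous_on A (\<lambda>x. \<phi> (f x))" "continuous_on A (\<lambda>x. px (f x))" "continuous_on A (\<lambda>x. pt (f x))"
  using assms phi_cont px_cont pt_cont by (auto intro: continuous_on_compose2)

lemma phi_ray_deriv:
  "((\<lambda>\<xi>. \<phi> (t * \<xi>, t)) has_field_derivative t * px (t * \<xi>, t)) (at \<xi>)"
proof -
  have "((\<lambda>\<xi>. (t * \<xi>, t)) has_derivative (\<lambda>h. (t * h, 0))) (at \<xi>)"
    by (auto intro!: derivative_eq_intros)
  from has_derivative_compose[OF this phi_deriv] show ?thesis
    by (auto simp: has_field_derivative_def fun_eq_iff algebra_simps elim!: has_derivative_eq_rhs)
qed

text \<open>The derivative in \<open>t\<close> of \<open>t \<phi>(t \<xi>, t)\<close>, that is, of \<open>\<phi>\<close> along the ray of celerity \<open>\<xi>\<close> weighted by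
  the Jacobian \<open>t\<close> of the change of variables \<open>x = t \<xi>\<close>.\<close>

definition radial :: "real \<Rightarrow> real \<Rightarrow> real" where
  "radial \<xi> t = \<phi> (t * \<xi>, t) + t * (\<xi> * px (t * \<xi>, t) + pt (t * \<xi>, t))"

lemma radial_deriv:
  "((\<lambda>t. t * \<phi> (t * \<xi>, t)) has_field_derivative radial \<xi> t) (at t)"
proof -
  have "((\<lambda>t. (t * \<xi>, t)) has_derivative (\<lambda>h. (h * \<xi>, h))) (at t)"
    by (auto intro!: derivative_eq_intros)
  from has_derivative_compose[OF this phi_deriv]
  have "((\<lambda>t. \<phi> (t * \<xi>, t)) has_field_derivative \<xi> * px (t * \<xi>, t) + pt (t * \<xi>, t)) (at t)"
    by (auto simp: has_field_derivative_def fun_eq_iff algebra_simps elim!: has_derivative_eq_rhs)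
  then show ?thesis
    by (auto intro!: derivative_eq_intros simp: radial_def algebra_simps)
qed

lemma radial_measurable [measurable]: "(\<lambda>z. radial (fst z) (snd z)) \<in> borel_measurable borel"
  unfolding radial_def borel_prod[symmetric] by measurable

lemma integral_radial:
  assumes "0 < \<delta>"
  shows "integrable lborel (\<lambda>t. indicator {\<delta><..} t * radial \<xi> t)"
    and "(LBINT t. indicator {\<delta><..} t * radial \<xi> t) = - \<delta> * \<phi> (\<delta> * \<xi>, \<delta>)"
proof -
  define T' where "T' = max T \<delta>"
  have T': "\<delta> \<le> T'" "T \<le> T'" by (auto simp: T'_def)
  have zero: "radial \<xi> t = 0" if "T' \<le> t" for t
  proof -
    have "T \<le> \<bar>t\<bar>" using that T' by linarith
    then show ?thesis using support[of "(t * \<xi>, t)"] by (simp add: radial_def)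
  qed
  have "(radial \<xi> has_integral T' * \<phi> (T' * \<xi>, T') - \<delta> * \<phi> (\<delta> * \<xi>, \<delta>)) {\<delta>..T'}"
    using radial_deriv T'
    by (intro fundamental_theorem_of_calculus)
       (auto simp: has_real_derivative_iff_has_vector_derivative[symmetric]
             intro: DERIV_subset)
  \<comment> \<open>Above \<open>T'\<close> the integrand vanishes, so only the lower end of the ray contributes.\<close>
  moreover have "\<phi> (T' * \<xi>, T') = 0"
    using support[of "(T' * \<xi>, T')"] T' abs_ge_self[of T'] by (auto dest: order_trans)
  ultimately have "((\<lambda>t. if t \<in> {\<delta>..T'} then radial \<xi> t else 0) has_integral - \<delta> * \<phi> (\<delta> * \<xi>, \<delta>)) UNIV"
    unfolding has_integral_restrict_UNIV by simp
  then have 1: "((\<lambda>t. indicator {\<delta><..} t * radial \<xi> t) has_integral - \<delta> * \<phi> (\<delta> * \<xi>, \<delta>)) UNIV"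
    by (rule has_integral_spike_finite[where S = "{\<delta>}", rotated 2])
       (auto simp: indicator_def zero)
  have "continuous_on {\<delta>..T'} (\<lambda>t. radial \<xi> t)"
    unfolding radial_def by (intro continuous_intros)
  then obtain C where C: "0 < C" "\<And>t. t \<in> {\<delta>..T'} \<Longrightarrow> norm (radial \<xi> t) \<le> C"
    using continuous_image_norm_bound[OF _ compact_Icc] by blast
  have [measurable]: "radial \<xi> \<in> borel_measurable borel"
    unfolding radial_def by measurable
  show int: "integrable lborel (\<lambda>t. indicator {\<delta><..} t * radial \<xi> t)"
    by (rule integrable_lborel_bounded_support[where K = "{\<delta>..T'}" and B = C])
       (use C in \<open>auto simp: indicator_def zero\<close>)
  show "(LBINT t. indicator {\<delta><..} t * radial \<xi> t) = - \<delta> * \<phi> (\<delta> * \<xi>, \<delta>)"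
    by (rule has_integral_unique[OF has_integral_integral_lborel[OF int] 1])
qed

end

locale weak_formulation = self_similar_pattern U G H S B + plane_test_function \<phi> px pt T
  for U G H :: "real \<Rightarrow> 'b::euclidean_space" and S :: "real set" and B :: real 
  and \<phi> px pt :: "real \<times> real \<Rightarrow> real" and T :: real
begin

definition density :: "real \<times> real \<Rightarrow> 'b" where
  "density z = pt z *\<^sub>R U (fst z / snd z) + px z *\<^sub>R G (fst z / snd z)"

lemma density_measurable [measurable]: "density \<in> borel_measurable borel"
proof -
  have [measurable]: "px \<in> borel_measurable (borel \<Otimes>\<^sub>M borel)" "pt \<in> borel_measurable (borel \<Otimes>\<^sub>M borel)"
    using measurable_test by (simp_all add: borel_prod)
  show ?thesis
    unfolding density_def borel_prod[symmetric] by measurable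
qed

lemma density_integrable: "integrable lborel density"
proof -
  have ck: "compact ({-T..T} \<times> {-T..T})" by (intro compact_Times compact_Icc)
  obtain C where C: "0 < C" "\<And>z. z \<in> {-T..T} \<times> {-T..T} \<Longrightarrow> norm (pt z) \<le> C"
    using continuous_image_norm_bound[OF continuous_on_subset[OF pt_cont] ck] by auto
  obtain D where D: "0 < D" "\<And>z. z \<in> {-T..T} \<times> {-T..T} \<Longrightarrow> norm (px z) \<le> D"
    using continuous_image_norm_bound[OF continuous_on_subset[OF px_cont] ck] by auto
  show ?thesis
  proof (rule integrable_lborel_bounded_support[OF _ ck])
    fix z assume "z \<in> {-T..T} \<times> {-T..T}"
    then show "norm (density z) \<le> C * B + D * B"
      unfolding density_def using C D U_bound G_bound
      by (intro norm_triangle_le add_mono) (auto intro!: mult_mono)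
  next
    fix z :: "real \<times> real" assume "z \<notin> {-T..T} \<times> {-T..T}"
    then have "T \<le> \<bar>fst z\<bar> \<or> T \<le> \<bar>snd z\<bar>" by (cases z) auto
    from support[OF this] show "density z = 0" by (simp add: density_def)
  qed measurable
qed

text \<open>The heart of the weak formulation. After the substitution \<open>x = t \<xi>\<close> the integrand differs from
  \<open>radial \<xi> t *\<^sub>R U \<xi>\<close> by \<open>D = (t px) (G - \<xi> U) - \<phi> U\<close>, which off \<open>S\<close> is the derivative in \<open>\<xi>\<close> of
  \<open>\<phi>(t \<xi>, t) H(\<xi>)\<close>. Since \<open>H\<close> is continuous and \<open>\<phi>\<close> has compact support, \<open>D\<close> integrates to zero.\<close>

lemma slice_integral:
  assumes t: "0 < t"
  shows "(LBINT x. density (x, t)) = (LBINT \<xi>. radial \<xi> t *\<^sub>R U \<xi>)"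
proof -
  define D where "D \<xi> = (t * px (t * \<xi>, t)) *\<^sub>R (G \<xi> - \<xi> *\<^sub>R U \<xi>) - \<phi> (t * \<xi>, t) *\<^sub>R U \<xi>" for \<xi>
  define b where "b = T / t"
  have b: "0 \<le> b" "t * b = T" using t T_pos by (auto simp: b_def)
  have far: "T \<le> \<bar>t * \<xi>\<bar>" if "\<xi> \<notin> {-b..b}" for \<xi>
  proof -
    have "b \<le> \<bar>\<xi>\<bar>" using that by auto
    then have "t * b \<le> t * \<bar>\<xi>\<bar>" using t by simp
    then show ?thesis using b t by (simp add: abs_mult)
  qed
  have vanish: "\<phi> (t * \<xi>, t) = 0" "px (t * \<xi>, t) = 0" "pt (t * \<xi>, t) = 0" if "\<xi> \<notin> {-b..b}" for \<xi>
    using support[of "(t * \<xi>, t)"] far[OF that] by auto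
  have int: "integrable lborel (\<lambda>\<xi>. c \<xi> *\<^sub>R V \<xi>)"
    if c: "continuous_on UNIV c" and c_zero: "\<And>\<xi>. \<xi> \<notin> {-b..b} \<Longrightarrow> c \<xi> = 0" and V: "V \<in> borel_measurable borel" "\<And>\<xi>. norm (V \<xi>) \<le> B"
    for c :: "real \<Rightarrow> real" and V :: "real \<Rightarrow> 'b"
  proof -
    obtain C where C: "0 < C" "\<And>\<xi>. \<xi> \<in> {-b..b} \<Longrightarrow> norm (c \<xi>) \<le> C"
      using continuous_image_norm_bound[OF continuous_on_subset[OF c] compact_Icc] by auto
    have [measurable]: "c \<in> borel_measurable borel" "V \<in> borel_measurable borel"
      using c V by (auto intro: borel_measurable_continuous_onI)
    show ?thesis
      by (rule integrable_lborel_bounded_support[where K = "{-b..b}" and B = "C * B"])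
         (use C c_zero V in \<open>auto intro!: mult_mono\<close>)
  qed
  have int1: "integrable lborel (\<lambda>\<xi>. (t * pt (t * \<xi>, t)) *\<^sub>R U \<xi>)"
    by (rule int) (auto intro!: continuous_intros simp: vanish U_bound)
  have int2: "integrable lborel (\<lambda>\<xi>. (t * px (t * \<xi>, t)) *\<^sub>R G \<xi>)"
    by (rule int) (auto intro!: continuous_intros simp: vanish G_bound)
  have int3: "integrable lborel (\<lambda>\<xi>. radial \<xi> t *\<^sub>R U \<xi>)"
    unfolding radial_def by (rule int) (auto intro!: continuous_intros simp: vanish U_bound)
  have D_eq: "D = (\<lambda>\<xi>. (t * pt (t * \<xi>, t)) *\<^sub>R U \<xi> + (t * px (t * \<xi>, t)) *\<^sub>R G \<xi> - radial \<xi> t *\<^sub>R U \<xi>)"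
    by (auto simp: fun_eq_iff D_def radial_def algebra_simps)
  have D_int: "integrable lborel D"
    unfolding D_eq by (intro Bochner_Integration.integrable_add Bochner_Integration.integrable_diff int1 int2 int3)
  have "(D has_integral \<phi> (t * b, t) *\<^sub>R H b - \<phi> (t * (- b), t) *\<^sub>R H (- b)) {-b..b}"
  proof (rule fundamental_theorem_of_calculus_interior_strong[OF S_finite])
    fix \<xi> assume "\<xi> \<in> {-b<..<b} - S"
    then have "\<xi> \<notin> S" by auto
    from phi_ray_deriv[of t \<xi>] H_deriv[OF this] H_eq[OF this]
    show "((\<lambda>\<xi>. \<phi> (t * \<xi>, t) *\<^sub>R H \<xi>) has_vector_derivative D \<xi>) (at \<xi>)"
      by (auto intro!: derivative_eq_intros simp: D_def)
  qed (use b H_continuous in \<open>auto intro!: continuous_intros intro: continuous_on_subset\<close>)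
  moreover have "\<phi> (t * b, t) = 0" "\<phi> (t * (- b), t) = 0"
    using support[of "(t * b, t)"] support[of "(t * (-b), t)"] b abs_ge_self[of T] by simp_all
  ultimately have "(D has_integral 0) {-b..b}" by simp
  then have "(D has_integral 0) UNIV"
    by (rule has_integral_on_superset) (use vanish in \<open>auto simp: D_def\<close>)
  from has_integral_unique[OF has_integral_integral_lborel[OF D_int] this]
  have D0: "integral\<^sup>L lborel D = 0" .
  have "(LBINT x. density (x, t)) = t *\<^sub>R (LBINT \<xi>. density (0 + t * \<xi>, t))"
    using lborel_integral_real_affine[of t "\<lambda>x. density (x, t)" 0] t by simp
  also have "\<dots> = (LBINT \<xi>. t *\<^sub>R density (t * \<xi>, t))" by simp
  also have "\<dots> = (LBINT \<xi>. D \<xi> + radial \<xi> t *\<^sub>R U \<xi>)"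
    using t unfolding D_eq by (simp add: density_def algebra_simps)
  also have "\<dots> = integral\<^sup>L lborel D + (LBINT \<xi>. radial \<xi> t *\<^sub>R U \<xi>)"
    by (rule Bochner_Integration.integral_add[OF D_int int3])
  finally show ?thesis by (simp add: D0)
qed

text \<open>Above a positive time the celerities met by the support of \<open>\<phi>\<close> are bounded by \<open>T/\<delta>\<close>, so the
  integrals over slices may be exchanged with those over rays, and on each ray \<open>radial\<close> is an exact
  derivative. At \<open>\<delta> = 0\<close> this exchange would not be legitimate, because \<open>\<phi>(t \<xi>, t)\<close> need
  not be integrable in \<open>(\<xi>, t)\<close> near \<open>t = 0\<close>.\<close>

lemma integral_above:
  assumes d: "0 < \<delta>"
  shows "(LBINT z. indicator (UNIV \<times> {\<delta><..}) z *\<^sub>R density z) = - (LBINT x. \<phi> (x, \<delta>) *\<^sub>R U (x / \<delta>))"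
proof -
  define K where "K = {-(T/\<delta>)..T/\<delta>} \<times> {\<delta>..max T \<delta>}"
  have ck: "compact K" unfolding K_def by (intro compact_Times compact_Icc)
  have "continuous_on K (\<lambda>z. radial (fst z) (snd z))"
    unfolding radial_def by (intro continuous_intros)
  then obtain C where C: "0 < C" "\<And>z. z \<in> K \<Longrightarrow> norm (radial (fst z) (snd z)) \<le> C"
    using continuous_image_norm_bound[OF _ ck] by blast
  have outside: "radial \<xi> t = 0" if "\<delta> < t" "(\<xi>, t) \<notin> K" for \<xi> t
  proof -
    have "T \<le> \<bar>t * \<xi>\<bar> \<or> T \<le> \<bar>t\<bar>"
    proof (cases "T \<le> t")
      case False
      then have "T / \<delta> \<le> \<bar>\<xi>\<bar>" using that by (auto simp: K_def)
      then have "T \<le> \<delta> * \<bar>\<xi>\<bar>" using d by (simp add: field_simps)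
      also have "\<dots> \<le> t * \<bar>\<xi>\<bar>" using that by (intro mult_right_mono) auto
      finally show ?thesis using d that by (simp add: abs_mult)
    qed auto
    then show ?thesis using support[of "(t * \<xi>, t)"] by (auto simp: radial_def)
  qed
  define k where "k \<xi> t = indicator {\<delta><..} t *\<^sub>R (radial \<xi> t *\<^sub>R U \<xi>)" for \<xi> t
  have [measurable]: "(\<lambda>z. radial (fst z) (snd z)) \<in> borel_measurable (borel \<Otimes>\<^sub>M borel)"
    using radial_measurable unfolding borel_prod .
  have k_int: "integrable lborel (\<lambda>z. k (fst z) (snd z))"
  proof (rule integrable_lborel_bounded_support[OF _ ck])
    show "(\<lambda>z. k (fst z) (snd z)) \<in> borel_measurable borel"
      unfolding k_def borel_prod[symmetric] by measurable
    fix z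
    show "norm (k (fst z) (snd z)) \<le> C * B" if "z \<in> K"
      using C(2)[OF that] C(1) U_bound order_trans[OF norm_ge_zero U_bound]
      by (auto simp: k_def indicator_def intro!: mult_mono)
    show "k (fst z) (snd z) = 0" if "z \<notin> K"
      using outside[of "snd z" "fst z"] that by (auto simp: k_def indicator_def)
  qed
  have "integrable lborel (\<lambda>z. indicator (UNIV \<times> {\<delta><..}) z *\<^sub>R density z)"
    by (intro integrable_mult_indicator density_integrable) (auto simp: borel_open open_Times)
  then have d_int: "integrable (lborel \<Otimes>\<^sub>M lborel) (\<lambda>(x, t). indicator {\<delta><..} t *\<^sub>R density (x, t))"
    by (simp add: lborel_prod case_prod_unfold indicator_times)
  have "(LBINT z. indicator (UNIV \<times> {\<delta><..}) z *\<^sub>R density z)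
      = integral\<^sup>L (lborel \<Otimes>\<^sub>M lborel) (\<lambda>(x, t). indicator {\<delta><..} t *\<^sub>R density (x, t))"
    by (simp add: lborel_prod case_prod_unfold indicator_times)
  also have "\<dots> = (LBINT t. LBINT x. indicator {\<delta><..} t *\<^sub>R density (x, t))"
    by (rule lborel_pair.integral_snd[OF d_int, symmetric])
  also have "\<dots> = (LBINT t. LBINT \<xi>. k \<xi> t)"
  proof (rule Bochner_Integration.integral_cong[OF refl])
    fix t
    show "(LBINT x. indicator {\<delta><..} t *\<^sub>R density (x, t)) = (LBINT \<xi>. k \<xi> t)"
      using slice_integral[of t] d by (cases "\<delta> < t") (auto simp: k_def)
  qed
  also have "\<dots> = (LBINT \<xi>. LBINT t. k \<xi> t)"
    by (rule lborel_pair.Fubini_integral) (use k_int in \<open>simp add: lborel_prod case_prod_unfold\<close>)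
  also have "\<dots> = (LBINT \<xi>. - (\<delta> *\<^sub>R \<phi> (\<delta> * \<xi>, \<delta>) *\<^sub>R U \<xi>))"
  proof (rule Bochner_Integration.integral_cong[OF refl])
    fix \<xi>
    have "(LBINT t. k \<xi> t) = (LBINT t. (indicator {\<delta><..} t * radial \<xi> t) *\<^sub>R U \<xi>)"
      by (simp add: k_def)
    also have "\<dots> = (LBINT t. indicator {\<delta><..} t * radial \<xi> t) *\<^sub>R U \<xi>"
      by (rule integral_scaleR_left) (rule integral_radial[OF d])
    finally show "(LBINT t. k \<xi> t) = - (\<delta> *\<^sub>R \<phi> (\<delta> * \<xi>, \<delta>) *\<^sub>R U \<xi>)"
      using integral_radial(2)[OF d] by simp
  qed
  also have "\<dots> = - (\<delta> *\<^sub>R (LBINT \<xi>. \<phi> (\<delta> * \<xi>, \<delta>) *\<^sub>R U \<xi>))"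
    by (simp only: Bochner_Integration.integral_minus integral_scaleR_right)
  also have "\<dots> = - (LBINT x. \<phi> (x, \<delta>) *\<^sub>R U (x / \<delta>))"
    using lborel_integral_real_affine[of \<delta> "\<lambda>x. \<phi> (x, \<delta>) *\<^sub>R U (x / \<delta>)" 0] d by simp
  finally show ?thesis .
qed

text \<open>Letting \<open>\<delta>\<close> tend to 0, the rescaled profile \<open>U(x/\<delta>)\<close> tends to its limit states for every
  \<open>x \<noteq> 0\<close>, which produces the initial datum.\<close>

lemma weak_identity:
  assumes left: "\<And>\<xi>. \<xi> < - L \<Longrightarrow> U \<xi> = a" and right: "\<And>\<xi>. L < \<xi> \<Longrightarrow> U \<xi> = b"
    and u0: "\<And>x. x < 0 \<Longrightarrow> u0 x = a" "\<And>x. 0 < x \<Longrightarrow> u0 x = b"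
    and u0_measurable: "u0 \<in> borel_measurable borel"
  shows "(LINT z:UNIV \<times> {0<..}|lborel. density z) + (LBINT x. \<phi> (x, 0) *\<^sub>R u0 x) = 0"
proof -
  define \<delta> where "\<delta> n = 1 / real (Suc n)" for n
  have \<delta>: "0 < \<delta> n" "\<delta> n \<le> 1" for n by (auto simp: \<delta>_def)
  have \<delta>0: "\<delta> \<longlonglongrightarrow> 0" unfolding \<delta>_def by (rule LIMSEQ_Suc[OF lim_1_over_n])
  have below: "\<forall>\<^sub>F n in sequentially. \<delta> n < c" if "0 < c" for c
    using order_tendstoD(2)[OF \<delta>0 that] .
  have [measurable]: "u0 \<in> borel_measurable borel" "UNIV \<times> {c<..} \<in> sets borel" for c :: real
    using u0_measurable by (auto simp: borel_open open_Times)
  have "(\<lambda>n. LBINT z. indicator (UNIV \<times> {\<delta> n<..}) z *\<^sub>R density z) \<longlonglongrightarrow>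
      (LBINT z. indicator (UNIV \<times> {0<..}) z *\<^sub>R density z)"
  proof (rule integral_dominated_convergence[where w = "\<lambda>z. norm (density z)"])
    show "AE z in lborel. (\<lambda>n. indicator (UNIV \<times> {\<delta> n<..}) z *\<^sub>R density z)
        \<longlonglongrightarrow> indicator (UNIV \<times> {0<..}) z *\<^sub>R density z"
    proof (rule AE_I2)
      fix z :: "real \<times> real"
      have "\<forall>\<^sub>F n in sequentially. indicator (UNIV \<times> {\<delta> n<..}) z = (indicator (UNIV \<times> {0<..}) z :: real)"
      proof (cases "0 < snd z")
        case True
        from below[OF this] show ?thesis
          by eventually_elim (use True in \<open>auto simp: indicator_def\<close>)
      next
        case False
        then have "\<not> \<delta> n < snd z" for n using \<delta>(1)[of n] by linarith
        then have "indicator (UNIV \<times> {\<delta> n<..}) z = (indicator (UNIV \<times> {0<..}) z :: real)" for n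
          using False by (cases z) (auto simp: indicator_def)
        then show ?thesis by (intro always_eventually allI)
      qed
      then show "(\<lambda>n. indicator (UNIV \<times> {\<delta> n<..}) z *\<^sub>R density z)
        \<longlonglongrightarrow> indicator (UNIV \<times> {0<..}) z *\<^sub>R density z"
        by (intro tendsto_eventually) (auto elim: eventually_mono)
    qed
  qed (use density_integrable in \<open>auto simp: indicator_def\<close>)
  then have 1: "(\<lambda>n. - (LBINT x. \<phi> (x, \<delta> n) *\<^sub>R U (x / \<delta> n))) \<longlonglongrightarrow>
      (LINT z:UNIV \<times> {0<..}|lborel. density z)"
    by (simp add: integral_above[OF \<delta>(1)] set_lebesgue_integral_def)
  have ck: "compact ({-T..T} \<times> {0..1::real})" by (intro compact_Times compact_Icc)
  obtain C where C: "0 < C" "\<And>z. z \<in> {-T..T} \<times> {0..1} \<Longrightarrow> norm (\<phi> z) \<le> C"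
    using continuous_image_norm_bound[OF continuous_on_subset[OF phi_cont] ck] by auto
  have "(\<lambda>n. LBINT x. \<phi> (x, \<delta> n) *\<^sub>R U (x / \<delta> n)) \<longlonglongrightarrow> (LBINT x. \<phi> (x, 0) *\<^sub>R u0 x)"
  proof (rule integral_dominated_convergence[where w = "\<lambda>x. indicator {-T..T} x * (C * B)"])
    show "integrable lborel (\<lambda>x. indicator {-T..T} x * (C * B))"
      by (intro integrable_mult_left integrable_real_indicator) (auto simp: emeasure_lborel_Icc_eq)
    show "AE x in lborel. (\<lambda>n. \<phi> (x, \<delta> n) *\<^sub>R U (x / \<delta> n)) \<longlonglongrightarrow> \<phi> (x, 0) *\<^sub>R u0 x"
      using AE_lborel_singleton[of 0]
    proof eventually_elim
      fix x :: real assume x: "x \<noteq> 0"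
      have "\<forall>\<^sub>F n in sequentially. U (x / \<delta> n) = u0 x"
      proof -
        have "0 < \<bar>x\<bar> / (\<bar>L\<bar> + 1)" using x by simp
        from below[OF this] show ?thesis
        proof eventually_elim
          fix n assume "\<delta> n < \<bar>x\<bar> / (\<bar>L\<bar> + 1)"
          then have "\<bar>L\<bar> * \<delta> n < \<bar>x\<bar>" using \<delta>(1)[of n] by (simp add: field_simps)
          then have big: "\<bar>L\<bar> < \<bar>x\<bar> / \<delta> n" using \<delta>(1)[of n] by (simp add: field_simps)
          show "U (x / \<delta> n) = u0 x"
          proof (cases "x < 0")
            case True
            then have "x / \<delta> n < - L" using big by auto
            then show ?thesis using left u0 True by auto
          next
            case False
            then have "L < x / \<delta> n" using big by auto
            then show ?thesis using right u0 False x by auto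
          qed
        qed
      qed
      then have "(\<lambda>n. U (x / \<delta> n)) \<longlonglongrightarrow> u0 x" by (rule tendsto_eventually)
      moreover have "(\<lambda>n. \<phi> (x, \<delta> n)) \<longlonglongrightarrow> \<phi> (x, 0)"
        using phi_cont \<delta>0
        by (intro continuous_on_tendsto_compose[OF phi_cont]) (auto intro!: tendsto_intros)
      ultimately show "(\<lambda>n. \<phi> (x, \<delta> n) *\<^sub>R U (x / \<delta> n)) \<longlonglongrightarrow> \<phi> (x, 0) *\<^sub>R u0 x"
        by (intro tendsto_scaleR)
    qed
    fix n
    have "norm (\<phi> (x, \<delta> n) *\<^sub>R U (x / \<delta> n)) \<le> indicator {-T..T} x * (C * B)" for x
    proof (cases "x \<in> {-T..T}")
      case True
      then show ?thesis using C(2)[of "(x, \<delta> n)"] C(1) U_bound[of "x / \<delta> n"] \<delta>[of n]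
        by (auto intro!: mult_mono simp: less_imp_le)
    next
      case False
      then have "T \<le> \<bar>x\<bar>" by auto
      then show ?thesis using False support[of "(x, \<delta> n)"] by (auto simp: indicator_def)
    qed
    then show "AE x in lborel. norm (\<phi> (x, \<delta> n) *\<^sub>R U (x / \<delta> n)) \<le> indicator {-T..T} x * (C * B)"
      by simp
  qed measurable
  from tendsto_minus[OF this] 1 have "(LINT z:UNIV \<times> {0<..}|lborel. density z) = - (LBINT x. \<phi> (x, 0) *\<^sub>R u0 x)"
    using LIMSEQ_unique by blast
  then show ?thesis by simp
qed

end

section \<open>Wave patterns are weak solutions\<close>

lemma borel_measurable_continuous_off_finite:
  fixes f :: "real \<Rightarrow> 'b::euclidean_space"
  assumes "finite S" "\<And>\<xi>. \<xi> \<notin> S \<Longrightarrow> isCont f \<xi>"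
  shows "f \<in> borel_measurable borel"
proof -
  have "continuous_on (- S) f" using assms(2) by (auto intro!: continuous_at_imp_continuous_on)
  then have "(\<lambda>\<xi>. indicator (- S) \<xi> *\<^sub>R f \<xi>) \<in> borel_measurable borel"
    using borel_open[OF open_Compl[OF finite_imp_closed[OF assms(1)]]]
    by (intro borel_measurable_continuous_on_indicator)
  then show ?thesis
    by (rule measurable_discrete_difference[where X = S])
       (use assms(1) in \<open>auto simp: countable_finite\<close>)
qed

text \<open>One-sided limits bound the function near each point; compactness of \<open>{-L..L}\<close> does the rest.\<close>

lemma bounded_range_one_sided_limits:
  fixes f :: "real \<Rightarrow> 'b::real_normed_vector"
  assumes lim: "\<And>\<xi>. \<exists>a b. (f \<longlongrightarrow> a) (at_left \<xi>) \<and> (f \<longlongrightarrow> b) (at_right \<xi>)"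
    and left: "\<And>\<xi>. \<xi> < - L \<Longrightarrow> f \<xi> = fl" and right: "\<And>\<xi>. L < \<xi> \<Longrightarrow> f \<xi> = fr"
  shows "bounded (range f)"
proof -
  have loc: "\<exists>N. open N \<and> \<xi> \<in> N \<and> bounded (f ` N)" for \<xi>
  proof -
    obtain a b where ab: "(f \<longlongrightarrow> a) (at_left \<xi>)" "(f \<longlongrightarrow> b) (at_right \<xi>)" using lim by blast
    have "\<forall>\<^sub>F x in at_left \<xi>. f x \<in> ball a 1 \<union> ball b 1"
      using topological_tendstoD[OF ab(1) open_ball, of a 1] by (auto elim: eventually_mono)
    moreover have "\<forall>\<^sub>F x in at_right \<xi>. f x \<in> ball a 1 \<union> ball b 1"
      using topological_tendstoD[OF ab(2) open_ball, of b 1] by (auto elim: eventually_mono)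
    ultimately have "\<forall>\<^sub>F x in at \<xi>. f x \<in> ball a 1 \<union> ball b 1"
      by (simp add: eventually_at_split)
    then obtain N where N: "open N" "\<xi> \<in> N" "\<And>x. x \<in> N \<Longrightarrow> x \<noteq> \<xi> \<Longrightarrow> f x \<in> ball a 1 \<union> ball b 1"
      unfolding eventually_at_topological by auto
    have "f ` N \<subseteq> insert (f \<xi>) (ball a 1 \<union> ball b 1)"
    proof (rule image_subsetI)
      fix x assume "x \<in> N"
      then show "f x \<in> insert (f \<xi>) (ball a 1 \<union> ball b 1)" using N(3)[of x] by (cases "x = \<xi>") auto
    qed
    then have "bounded (f ` N)" by (rule bounded_subset[rotated]) simp
    with N show ?thesis by blast
  qed
  define C where "C = {N. open N \<and> bounded (f ` N)}"
  have "{-L..L} \<subseteq> \<Union>C" using loc by (auto simp: C_def)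
  moreover have "\<And>N. N \<in> C \<Longrightarrow> open N" by (auto simp: C_def)
  ultimately obtain D where D: "D \<subseteq> C" "finite D" "{-L..L} \<subseteq> \<Union>D"
    by (rule compactE[OF compact_Icc])
  have "bounded (\<Union>N\<in>D. f ` N)" using D by (intro bounded_UN) (auto simp: C_def)
  moreover have "range f \<subseteq> insert fl (insert fr (\<Union>N\<in>D. f ` N))"
  proof (rule image_subsetI)
    fix \<xi>
    show "f \<xi> \<in> insert fl (insert fr (\<Union>N\<in>D. f ` N))"
    proof (cases "\<xi> \<in> {-L..L}")
      case True
      then show ?thesis using D(3) by blast
    next
      case False
      then show ?thesis using left[of \<xi>] right[of \<xi>] by (cases "\<xi> < - L") auto
    qed
  qed
  ultimately show ?thesis by (meson bounded_insert bounded_subset)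
qed

lemma test_function_imp_plane_test_function:
  assumes "test_function \<phi>"
  obtains T where "plane_test_function \<phi>
    (\<lambda>z. frechet_derivative \<phi> (at z) (1, 0)) (\<lambda>z. frechet_derivative \<phi> (at z) (0, 1)) T"
proof -
  obtain \<phi>' where \<phi>': "\<And>z. (\<phi> has_derivative blinfun_apply (\<phi>' z)) (at z)" "continuous_on UNIV \<phi>'"
    using assms unfolding test_function_def C1_on_def by auto
  have fd: "frechet_derivative \<phi> (at z) = blinfun_apply (\<phi>' z)" for z
    using frechet_derivative_at[OF \<phi>'(1)] by simp
  have "bounded (closure {z. \<phi> z \<noteq> 0})"
    using assms compact_imp_bounded unfolding test_function_def by blast
  then have "bounded {z. \<phi> z \<noteq> 0}" by (rule bounded_subset[OF _ closure_subset])
  then obtain b where b: "0 < b" "\<And>z. \<phi> z \<noteq> 0 \<Longrightarrow> norm z \<le> b"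
    unfolding bounded_pos by auto
  have zero: "\<phi> z = 0 \<and> blinfun_apply (\<phi>' z) v = 0" if "b < norm z" for z v
  proof -
    have op: "open {z :: real \<times> real. b < norm z}"
      by (intro open_Collect_less continuous_intros)
    have "((\<lambda>_. 0) has_derivative blinfun_apply (\<phi>' z)) (at z)"
      by (rule has_derivative_transform_within_open[OF \<phi>'(1) op])
         (use that b(2) in \<open>force+\<close>)
    then have "blinfun_apply (\<phi>' z) = (\<lambda>_. 0)"
      by (intro has_derivative_unique[of "\<lambda>_. 0" _ z]) auto
    then show ?thesis using b(2)[of z] that by auto
  qed
  show ?thesis
  proof (rule that[of "b + 1"], unfold fd, unfold_locales)
    fix z :: "real \<times> real"
    have "blinfun_apply (\<phi>' z) h = fst h * blinfun_apply (\<phi>' z) (1, 0) + snd h * blinfun_apply (\<phi>' z) (0, 1)" for h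
    proof -
      have "h = fst h *\<^sub>R (1, 0) + snd h *\<^sub>R (0, 1)" by (cases h) simp
      then show ?thesis by (metis blinfun.add_right blinfun.scaleR_right real_scaleR_def)
    qed
    then have "blinfun_apply (\<phi>' z) = (\<lambda>h. fst h * blinfun_apply (\<phi>' z) (1, 0) + snd h * blinfun_apply (\<phi>' z) (0, 1))"
      by (rule ext)
    then show "(\<phi> has_derivative (\<lambda>h. fst h * blinfun_apply (\<phi>' z) (1, 0) + snd h * blinfun_apply (\<phi>' z) (0, 1))) (at z)"
      by (rule has_derivative_eq_rhs[OF \<phi>'(1)])
  next
    fix z :: "real \<times> real" assume "b + 1 \<le> \<bar>fst z\<bar> \<or> b + 1 \<le> \<bar>snd z\<bar>"
    moreover have "\<bar>fst z\<bar> \<le> norm z" "\<bar>snd z\<bar> \<le> norm z"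
      using norm_fst_le[of "fst z" "snd z"] norm_snd_le[of "snd z" "fst z"] by auto
    ultimately have "b < norm z" by linarith
    then show "\<phi> z = 0 \<and> blinfun_apply (\<phi>' z) (1, 0) = 0 \<and> blinfun_apply (\<phi>' z) (0, 1) = 0"
      using zero by blast
  qed (use b(1) \<phi>'(2) in \<open>auto intro!: continuous_intros\<close>)
qed

lemma has_vector_derivative_along_curve:
  assumes "f differentiable at (c t)" "(c has_vector_derivative v) (at t)"
  shows "((\<lambda>x. f (c x)) has_vector_derivative frechet_derivative f (at (c t)) v) (at t)"
proof -
  have "(f has_derivative frechet_derivative f (at (c t))) (at (c t) within range c)"
    using assms(1) frechet_derivative_works has_derivative_at_withinI by blast
  from vector_derivative_diff_chain_within[OF assms(2) this] show ?thesis by (simp add: o_def)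
qed

lemma C2_on_differentiable: "C2_on f S \<Longrightarrow> x \<in> S \<Longrightarrow> f differentiable at x"
  unfolding C2_on_def differentiable_def by blast

lemma rankine_hugoniot:
  "lax_shock F lam j s a b \<Longrightarrow> F b - F a = s *\<^sub>R (b - a)"
  "contact_discontinuity F Om lam R j s a b \<Longrightarrow> F b - F a = s *\<^sub>R (b - a)"
  by (auto simp: lax_shock_def contact_discontinuity_def)

text \<open>On a constant piece and on a rarefaction alike, \<open>dF(U) U' = \<xi> U'\<close>, hence \<open>K = F(U) - \<xi> U\<close> has derivative
  \<open>- U\<close> there; at a discontinuity of celerity \<open>s\<close> the Rankine-Hugoniot relation says that the two
  one-sided limits of \<open>K\<close> coincide. So \<open>K\<close>, corrected at the finitely many celerities of the
  discontinuities, is the primitive that the weak formulation needs.\<close>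

theorem composed_of_waves_imp_entropy_solution:
  fixes F :: "real^'m \<Rightarrow> real^'m"
  assumes F: "\<And>W. W \<in> Om \<Longrightarrow> F differentiable at W"
    and hyp: "strictly_hyperbolic F Om lam R"
    and comp: "composed_of_waves F Om lam R U"
    and left: "\<And>\<xi>. \<xi> < - L \<Longrightarrow> U \<xi> = a" and right: "\<And>\<xi>. L < \<xi> \<Longrightarrow> U \<xi> = b"
  shows "entropy_solution F Om lam R (\<lambda>x. if x < 0 then a else b) U"
proof -
  have U_in: "U \<xi> \<in> Om" for \<xi> using comp by (auto simp: composed_of_waves_def)
  obtain S where S: "finite S"
    and smooth: "\<forall>I\<in>components (- S). U constant_on I \<or>
           (\<exists>j\<in>{1..CARD('m)}. genuinely_nonlinear Om lam R j \<and>
              (\<forall>\<xi>\<in>I. lam j (U \<xi>) = \<xi> \<and> (U has_vector_derivative R j (U \<xi>)) (at \<xi>)))"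
    and jump: "\<forall>s\<in>S. \<exists>a\<in>Om. \<exists>b\<in>Om. (U \<longlongrightarrow> a) (at_left s) \<and> (U \<longlongrightarrow> b) (at_right s) \<and>
           (a = b \<or> (\<exists>j\<in>{1..CARD('m)}.
               genuinely_nonlinear Om lam R j \<and> lax_shock F lam j s a b \<or>
               linearly_degenerate Om lam R j \<and> contact_discontinuity F Om lam R j s a b))"
    using comp unfolding composed_of_waves_def by (elim conjE exE) (rule that)
  have F_cont: "isCont F W" if "W \<in> Om" for W
    using F[OF that] by (rule differentiable_imp_continuous_within)
  have open_S: "open (- S)" using S by (simp add: finite_imp_closed open_Compl)
  \<comment> \<open>Constant states and rarefactions are treated together: \<open>v\<close> is 0 on the former and the
    eigenvector \<open>R j\<close> on the latter, where the eigenvalue equals the celerity.\<close>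
  have deriv: "\<exists>v. (U has_vector_derivative v) (at \<xi>) \<and> frechet_derivative F (at (U \<xi>)) v = \<xi> *\<^sub>R v"
    if "\<xi> \<notin> S" for \<xi>
  proof -
    define I where "I = connected_component_set (- S) \<xi>"
    have I: "I \<in> components (- S)" "open I" "\<xi> \<in> I"
      using that open_S by (auto simp: I_def componentsI open_connected_component)
    from bspec[OF smooth I(1)] show ?thesis
    proof
      assume "U constant_on I"
      then obtain c where c: "\<And>x. x \<in> I \<Longrightarrow> U x = c" unfolding constant_on_def by blast
      have "(U has_vector_derivative 0) (at \<xi>)"
        by (rule has_vector_derivative_transform_within_open[OF has_vector_derivative_const I(2,3)])
           (simp add: c)
      moreover have "frechet_derivative F (at (U \<xi>)) 0 = 0"
        using linear_frechet_derivative[OF F[OF U_in]] by (rule linear_0)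
      ultimately show ?thesis by (intro exI[of _ 0]) simp
    next
      assume "\<exists>j\<in>{1..CARD('m)}. genuinely_nonlinear Om lam R j \<and>
              (\<forall>\<xi>\<in>I. lam j (U \<xi>) = \<xi> \<and> (U has_vector_derivative R j (U \<xi>)) (at \<xi>))"
      then show ?thesis using hyp I(3) U_in unfolding strictly_hyperbolic_def by metis
    qed
  qed
  have U_cont: "isCont U \<xi>" if "\<xi> \<notin> S" for \<xi>
    using deriv[OF that] has_vector_derivative_continuous by blast
  have FU_cont: "isCont (\<lambda>\<xi>. F (U \<xi>)) \<xi>" if "\<xi> \<notin> S" for \<xi>
    using U_cont[OF that] F_cont[OF U_in] by (rule isCont_o2)
  have U_lim: "\<exists>c\<in>Om. \<exists>d\<in>Om. (U \<longlongrightarrow> c) (at_left \<xi>) \<and> (U \<longlongrightarrow> d) (at_right \<xi>) \<and> F d - F c = \<xi> *\<^sub>R (d - c)" for \<xi>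
  proof (cases "\<xi> \<in> S")
    case True
    then show ?thesis using bspec[OF jump True] rankine_hugoniot by (metis cancel_comm_monoid_add_class.diff_cancel scaleR_zero_right)
  next
    case False
    then have "(U \<longlongrightarrow> U \<xi>) (at \<xi>)" using U_cont by (simp add: isCont_def)
    then have "(U \<longlongrightarrow> U \<xi>) (at_left \<xi>)" "(U \<longlongrightarrow> U \<xi>) (at_right \<xi>)"
      by (simp_all add: filterlim_at_split)
    then show ?thesis using U_in by force
  qed
  have FU_lim: "\<exists>c d. ((\<lambda>\<xi>. F (U \<xi>)) \<longlongrightarrow> c) (at_left \<xi>) \<and> ((\<lambda>\<xi>. F (U \<xi>)) \<longlongrightarrow> d) (at_right \<xi>)" for \<xi>
    using U_lim[of \<xi>] F_cont isCont_tendsto_compose by blast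
  have "bounded (range U)"
    by (rule bounded_range_one_sided_limits[OF _ left right]) (use U_lim in blast)
  moreover have "bounded (range (\<lambda>\<xi>. F (U \<xi>)))"
    by (rule bounded_range_one_sided_limits[OF FU_lim, of L "F a" "F b"]) (simp_all add: left right)
  ultimately obtain B1 B2 where B12: "\<And>\<xi>. norm (U \<xi>) \<le> B1" "\<And>\<xi>. norm (F (U \<xi>)) \<le> B2"
    unfolding bounded_iff by auto
  define B where "B = max B1 B2"
  have B: "norm (U \<xi>) \<le> B" "norm (F (U \<xi>)) \<le> B" for \<xi>
    using B12[of \<xi>] by (auto simp: B_def)
  define K where "K \<xi> = F (U \<xi>) - \<xi> *\<^sub>R U \<xi>" for \<xi>
  have K_lim: "\<exists>l. (K \<longlongrightarrow> l) (at \<xi>)" for \<xi>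
  proof -
    obtain c d where cd: "c \<in> Om" "d \<in> Om" "(U \<longlongrightarrow> c) (at_left \<xi>)" "(U \<longlongrightarrow> d) (at_right \<xi>)"
      and rh: "F d - F c = \<xi> *\<^sub>R (d - c)" using U_lim by blast
    have "(K \<longlongrightarrow> F c - \<xi> *\<^sub>R c) (at_left \<xi>)"
      unfolding K_def by (intro tendsto_intros isCont_tendsto_compose[OF F_cont] cd)
    moreover have "(K \<longlongrightarrow> F d - \<xi> *\<^sub>R d) (at_right \<xi>)"
      unfolding K_def by (intro tendsto_intros isCont_tendsto_compose[OF F_cont] cd)
    moreover have "F d - \<xi> *\<^sub>R d = F c - \<xi> *\<^sub>R c" using rh by (simp add: algebra_simps)
    ultimately show ?thesis by (auto simp: filterlim_at_split)
  qed
  \<comment> \<open>The limit function \<open>l\<close> is the continuous version of \<open>K\<close>.\<close>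
  then obtain l where l: "\<And>\<xi>. (K \<longlongrightarrow> l \<xi>) (at \<xi>)" by metis
  have l_eq: "l \<xi> = K \<xi>" if "\<xi> \<notin> S" for \<xi>
  proof -
    have "isCont K \<xi>" unfolding K_def by (intro continuous_intros U_cont FU_cont that)
    then show ?thesis using l LIM_unique unfolding isCont_def by blast
  qed
  have "isCont l \<xi>" for \<xi>
  proof -
    have "\<forall>\<^sub>F x in at \<xi>. x \<notin> S"
      using islimpt_finite[OF S, of \<xi>] by (simp add: islimpt_iff_eventually)
    then have "\<forall>\<^sub>F x in at \<xi>. l x = K x" by eventually_elim (rule l_eq)
    from tendsto_cong[OF this, of "l \<xi>"] l show ?thesis unfolding isCont_def by simp
  qed
  then have l_cont: "continuous_on UNIV l" by (simp add: continuous_at_imp_continuous_on)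
  have l_deriv: "(l has_vector_derivative - U \<xi>) (at \<xi>)" if xi: "\<xi> \<notin> S" for \<xi>
  proof -
    obtain v where v: "(U has_vector_derivative v) (at \<xi>)" "frechet_derivative F (at (U \<xi>)) v = \<xi> *\<^sub>R v"
      using deriv[OF xi] by blast
    have "((\<lambda>x. F (U x)) has_vector_derivative \<xi> *\<^sub>R v) (at \<xi>)"
      using has_vector_derivative_along_curve[OF F[OF U_in] v(1)] v(2) by simp
    then have "(K has_vector_derivative - U \<xi>) (at \<xi>)"
      unfolding K_def using v(1) by (auto intro!: derivative_eq_intros)
    then show ?thesis
      by (rule has_vector_derivative_transform_within_open[OF _ open_S]) (use xi l_eq in auto)
  qed
  interpret self_similar_pattern U "\<lambda>\<xi>. F (U \<xi>)" l S B
    by unfold_locales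
       (use S U_cont FU_cont B l_cont l_deriv l_eq in
         \<open>auto intro: borel_measurable_continuous_off_finite simp: K_def\<close>)
  have local_int: "set_integrable lborel (C \<inter> UNIV \<times> {0<..}) (\<lambda>(x, t). V (x / t))"
    if C: "compact C" and V: "V \<in> borel_measurable borel" and VB: "\<And>\<xi>. norm (V \<xi>) \<le> B"
    for C :: "(real \<times> real) set" and V :: "real \<Rightarrow> real^'m"
    unfolding set_integrable_def
  proof (rule integrable_lborel_bounded_support[OF _ C])
    have [measurable]: "C \<inter> UNIV \<times> {0<..} \<in> sets borel" "V \<in> borel_measurable borel"
      using C V by (auto simp: borel_compact borel_open open_Times)
    have [measurable]: "(\<lambda>(x, t). V (x / t)) \<in> borel_measurable borel"
      unfolding borel_prod[symmetric] by measurable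
    show "(\<lambda>z. indicator (C \<inter> UNIV \<times> {0<..}) z *\<^sub>R (case z of (x, t) \<Rightarrow> V (x / t))) \<in> borel_measurable borel"
      by measurable
    show "norm (indicator (C \<inter> UNIV \<times> {0<..}) z *\<^sub>R (case z of (x, t) \<Rightarrow> V (x / t))) \<le> B" for z
      using VB order_trans[OF norm_ge_zero VB] by (cases z) (auto simp: indicator_def)
  qed auto
  have u0_measurable: "(\<lambda>x :: real. if x < 0 then a else b) \<in> borel_measurable borel" by measurable
  have u0_int: "set_integrable lborel C (\<lambda>x. if x < 0 then a else b)" if C: "compact C" for C :: "real set"
    unfolding set_integrable_def
  proof (rule integrable_lborel_bounded_support[OF _ C])
    have [measurable]: "C \<in> sets borel" using C by (rule borel_compact)
    show "(\<lambda>x. indicator C x *\<^sub>R (if x < 0 then a else b)) \<in> borel_measurable borel" by measurable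
    show "norm (indicator C x *\<^sub>R (if x < 0 then a else b)) \<le> norm a + norm b" for x
      by (auto simp: indicator_def)
  qed auto
  have balance: "(LINT z:UNIV \<times> {0<..}|lborel.
           frechet_derivative \<phi> (at z) (0, 1) *\<^sub>R U (fst z / snd z) +
           frechet_derivative \<phi> (at z) (1, 0) *\<^sub>R F (U (fst z / snd z)))
        + (LINT x|lborel. \<phi> (x, 0) *\<^sub>R (if x < 0 then a else b)) = 0"
    if phi: "test_function \<phi>" for \<phi>
  proof -
    obtain T where "plane_test_function \<phi>
      (\<lambda>z. frechet_derivative \<phi> (at z) (1, 0)) (\<lambda>z. frechet_derivative \<phi> (at z) (0, 1)) T"
      by (rule test_function_imp_plane_test_function[OF phi])
    then interpret plane_test_function \<phi>
      "\<lambda>z. frechet_derivative \<phi> (at z) (1, 0)" "\<lambda>z. frechet_derivative \<phi> (at z) (0, 1)" T .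
    interpret weak_formulation U "\<lambda>\<xi>. F (U \<xi>)" l S B \<phi>
      "\<lambda>z. frechet_derivative \<phi> (at z) (1, 0)" "\<lambda>z. frechet_derivative \<phi> (at z) (0, 1)" T
      by unfold_locales
    show ?thesis
      using weak_identity[OF left right _ _ u0_measurable] unfolding density_def by simp
  qed
  show ?thesis
    unfolding entropy_solution_def weak_solution_def
    using U_in comp local_int[OF _ U_measurable B(1)] local_int[OF _ G_measurable B(2)] u0_int balance
    by auto
qed

section \<open>Simple waves and their superposition\<close>

lemma wave_curveD:
  assumes "wave_curve F Om lam R j Th chi sig" "W \<in> Om"
  shows "0 \<in> Th W" "chi 0 W = W"
    and "\<epsilon> \<in> Th W \<Longrightarrow> chi \<epsilon> W \<in> Om"
    and "\<epsilon> \<in> Th W \<Longrightarrow> isCont (\<lambda>e. chi e W) \<epsilon>"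
    and "\<epsilon> \<in> Th W \<Longrightarrow> genuinely_nonlinear Om lam R j \<Longrightarrow> 0 < \<epsilon> \<Longrightarrow>
      ((\<lambda>e. chi e W) has_vector_derivative R j (chi \<epsilon> W)) (at \<epsilon>)"
    and "\<epsilon> \<in> Th W \<Longrightarrow> genuinely_nonlinear Om lam R j \<Longrightarrow> \<epsilon> < 0 \<Longrightarrow>
      lax_shock F lam j (sig \<epsilon> W) W (chi \<epsilon> W)"
    and "\<epsilon> \<in> Th W \<Longrightarrow> linearly_degenerate Om lam R j \<Longrightarrow>
      ((\<lambda>e. chi e W) has_vector_derivative R j (chi \<epsilon> W)) (at \<epsilon>)"
proof -
  show "isCont (\<lambda>e. chi e W) \<epsilon>" if "\<epsilon> \<in> Th W"
    using assms that C2_on_differentiable[of "\<lambda>e. chi e W" "Th W" \<epsilon>] differentiable_imp_continuous_within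
    unfolding wave_curve_def by blast
qed (use assms in \<open>auto simp: wave_curve_def\<close>)

lemma not_genuinely_nonlinear_and_degenerate:
  "W \<in> Om \<Longrightarrow> genuinely_nonlinear Om lam R j \<Longrightarrow> linearly_degenerate Om lam R j \<Longrightarrow> False"
  unfolding genuinely_nonlinear_def linearly_degenerate_def by fastforce

text \<open>Genuine nonlinearity normalised to \<open>d\<lambda>\<^sub>j R\<^sub>j = 1\<close> makes the strength of a rarefaction the
  increment of its characteristic speed. Therefore \<open>\<xi> \<mapsto> chi (\<xi> - \<lambda>\<^sub>j(W)) W\<close> is parametrised by its own
  celerity and fills exactly the fan between the two celerities of the wave.\<close>

lemma rarefaction_eigenvalue:
  assumes wc: "wave_curve F Om lam R j Th chi sig" and W: "W \<in> Om"
    and gnl: "genuinely_nonlinear Om lam R j"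
    and \<epsilon>: "0 < \<epsilon>" "{0..\<epsilon>} \<subseteq> Th W" and e: "e \<in> {0..\<epsilon>}"
  shows "lam j (chi e W) = lam j W + e"
proof -
  note D = wave_curveD[OF wc W]
  have diff: "lam j differentiable at V" if "V \<in> Om" for V
    using gnl that by (auto simp: genuinely_nonlinear_def)
  define g where "g e = lam j (chi e W) - e" for e
  have "g e = g 0"
  proof (rule DERIV_isconst2[where a = 0 and b = \<epsilon>])
    show "continuous_on {0..\<epsilon>} g"
    proof (rule continuous_at_imp_continuous_on, rule ballI)
      fix x assume "x \<in> {0..\<epsilon>}"
      then have x: "x \<in> Th W" using \<epsilon> by auto
      have "isCont (lam j) (chi x W)"
        using diff[OF D(3)[OF x]] by (rule differentiable_imp_continuous_within)
      then show "isCont g x"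
        unfolding g_def by (intro continuous_intros isCont_o2[OF D(4)[OF x]])
    qed
    fix x assume "0 < x" "x < \<epsilon>"
    then have x: "x \<in> Th W" "0 < x" using \<epsilon> by auto
    have "frechet_derivative (lam j) (at (chi x W)) (R j (chi x W)) = 1"
      using gnl D(3)[OF x(1)] by (auto simp: genuinely_nonlinear_def)
    then have "((\<lambda>e. lam j (chi e W)) has_vector_derivative 1) (at x)"
      using has_vector_derivative_along_curve[OF diff[OF D(3)[OF x(1)]] D(5)[OF x(1) gnl x(2)]] by simp
    then show "DERIV g x :> 0"
      unfolding g_def by (auto intro!: derivative_eq_intros simp: has_real_derivative_iff_has_vector_derivative[symmetric])
  qed (use \<epsilon> e in auto)
  then show ?thesis using D(2) by (simp add: g_def)
qed

text \<open>Along the integral curve \<open>c\<close> of a degenerate field \<open>\<lambda>\<^sub>j\<close> is constant, because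
  \<open>d\<lambda>\<^sub>j R\<^sub>j = 0\<close>; with \<open>s\<close> its value, \<open>(F(c) - s c)' = (\<lambda>\<^sub>j(c) - s) R\<^sub>j(c) = 0\<close>, which is the
  Rankine-Hugoniot relation.\<close>

lemma contact_along_degenerate_curve:
  fixes F :: "real^'m \<Rightarrow> real^'m"
  assumes F: "\<And>W. W \<in> Om \<Longrightarrow> F differentiable at W"
    and hyp: "strictly_hyperbolic F Om lam R" and j: "j \<in> {1..CARD('m)}"
    and wc: "wave_curve F Om lam R j Th chi sig" and W: "W \<in> Om"
    and ld: "linearly_degenerate Om lam R j" and seg: "closed_segment 0 \<epsilon> \<subseteq> Th W"
  shows "contact_discontinuity F Om lam R j (lam j W) W (chi \<epsilon> W)"
    and "lam j (chi \<epsilon> W) = lam j W"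
proof -
  note D = wave_curveD[OF wc W]
  let ?I = "closed_segment 0 \<epsilon>"
  have inO: "chi e W \<in> Om" if "e \<in> ?I" for e using D(3) that seg by blast
  have dc: "((\<lambda>e. chi e W) has_vector_derivative R j (chi e W)) (at e)" if "e \<in> ?I" for e
    using D(7) that seg ld by blast
  have lam_const: "lam j (chi e W) = lam j W" if e: "e \<in> ?I" for e
  proof -
    have "\<exists>c. \<forall>x\<in>?I. lam j (chi x W) = c"
    proof (rule has_derivative_zero_constant)
      fix x assume x: "x \<in> ?I"
      have "lam j differentiable at (chi x W)"
        "frechet_derivative (lam j) (at (chi x W)) (R j (chi x W)) = 0"
        using ld inO[OF x] by (auto simp: linearly_degenerate_def)
      with has_vector_derivative_along_curve[OF this(1) dc[OF x]]
      show "((\<lambda>e. lam j (chi e W)) has_derivative (\<lambda>h. 0)) (at x within ?I)"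
        by (simp add: has_vector_derivative_def has_derivative_at_withinI)
    qed simp
    then show ?thesis using e D(2) by (metis ends_in_segment(1))
  qed
  have "\<exists>c. \<forall>x\<in>?I. F (chi x W) - lam j W *\<^sub>R chi x W = c"
  proof (rule has_derivative_zero_constant)
    fix x assume x: "x \<in> ?I"
    have "frechet_derivative F (at (chi x W)) (R j (chi x W)) = lam j W *\<^sub>R R j (chi x W)"
      using hyp j inO[OF x] lam_const[OF x] unfolding strictly_hyperbolic_def by metis
    with has_vector_derivative_along_curve[OF F[OF inO[OF x]] dc[OF x]]
    have "((\<lambda>e. F (chi e W)) has_vector_derivative lam j W *\<^sub>R R j (chi x W)) (at x)" by simp
    then have "((\<lambda>e. F (chi e W) - lam j W *\<^sub>R chi e W) has_vector_derivative 0) (at x)"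
      using dc[OF x] by (auto intro!: derivative_eq_intros)
    then show "((\<lambda>e. F (chi e W) - lam j W *\<^sub>R chi e W) has_derivative (\<lambda>h. 0)) (at x within ?I)"
      by (simp add: has_vector_derivative_def has_derivative_at_withinI)
  qed simp
  then have "F (chi \<epsilon> W) - lam j W *\<^sub>R chi \<epsilon> W = F W - lam j W *\<^sub>R W"
    using D(2) by (metis ends_in_segment)
  then have "F (chi \<epsilon> W) - F W = lam j W *\<^sub>R (chi \<epsilon> W - W)" by (simp add: algebra_simps)
  moreover have "\<exists>c e. c 0 = W \<and> c e = chi \<epsilon> W \<and>
        (\<forall>\<tau>\<in>closed_segment 0 e. c \<tau> \<in> Om \<and> lam j (c \<tau>) = lam j W \<and>
           (c has_vector_derivative R j (c \<tau>)) (at \<tau> within closed_segment 0 e))"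
    by (intro exI[of _ "\<lambda>e. chi e W"] exI[of _ \<epsilon>])
       (use D(2) inO lam_const dc in \<open>auto intro: has_vector_derivative_at_within\<close>)
  ultimately show "contact_discontinuity F Om lam R j (lam j W) W (chi \<epsilon> W)"
    by (simp add: contact_discontinuity_def)
  show "lam j (chi \<epsilon> W) = lam j W" by (rule lam_const) simp
qed

definition admissible_jump where
  "admissible_jump F Om lam R s a b \<longleftrightarrow> a = b \<or> (\<exists>j\<in>{1..CARD('m)}.
     genuinely_nonlinear Om lam R j \<and> lax_shock F lam j s a b \<or>
     linearly_degenerate Om lam R j \<and> contact_discontinuity F Om lam R j s a b)"
  for F :: "real^'m \<Rightarrow> real^'m"

text \<open>The only dichotomy that matters when waves are glued: either the wave is a fan of positive
  width \<open>\<epsilon>\<close>, or it is concentrated on one celerity, where it is a shock, a contact discontinuity or,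
  for \<open>\<epsilon> = 0\<close> in a genuinely nonlinear field, no jump at all.\<close>

lemma simple_wave_cases:
  fixes F :: "real^'m \<Rightarrow> real^'m"
  assumes F: "\<And>W. W \<in> Om \<Longrightarrow> F differentiable at W"
    and hyp: "strictly_hyperbolic F Om lam R" and j: "j \<in> {1..CARD('m)}"
    and field: "genuinely_nonlinear Om lam R j \<or> linearly_degenerate Om lam R j"
    and wc: "wave_curve F Om lam R j Th (chi j) (sig j)" and W: "W \<in> Om"
    and seg: "closed_segment 0 \<epsilon> \<subseteq> Th W"
  defines "m1 \<equiv> celerity_min Om lam R sig j \<epsilon> W"
    and "m2 \<equiv> celerity_max Om lam R chi sig j \<epsilon> W"
  obtains (rarefaction) "genuinely_nonlinear Om lam R j" "0 < \<epsilon>" "m2 = m1 + \<epsilon>"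
      "m1 = lam j W" "m2 = lam j (chi j \<epsilon> W)" "\<And>e. e \<in> {0..\<epsilon>} \<Longrightarrow> lam j (chi j e W) = m1 + e"
    | (jump) "m1 = m2" "admissible_jump F Om lam R m1 W (chi j \<epsilon> W)"
      "lam j (chi j \<epsilon> W) \<le> m1" "m1 \<le> lam j W"
proof -
  note D = wave_curveD[OF wc W]
  have \<epsilon>: "\<epsilon> \<in> Th W" using seg by auto
  consider (r) "genuinely_nonlinear Om lam R j" "0 < \<epsilon>" | (z) "genuinely_nonlinear Om lam R j" "\<epsilon> = 0"
    | (s) "genuinely_nonlinear Om lam R j" "\<epsilon> < 0" | (c) "linearly_degenerate Om lam R j"
    using field by linarith
  then show thesis
  proof cases
    case r
    have "lam j (chi j e W) = lam j W + e" if "e \<in> {0..\<epsilon>}" for e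
      using rarefaction_eigenvalue[OF wc W r _ that] seg r by (simp add: closed_segment_eq_real_ivl)
    then show thesis using r by (intro rarefaction) (auto simp: m1_def m2_def celerity_min_def celerity_max_def)
  next
    case z
    then show thesis using D(2)
      by (intro jump) (auto simp: m1_def m2_def celerity_min_def celerity_max_def admissible_jump_def)
  next
    case s
    from D(6)[OF \<epsilon> s] have "lax_shock F lam j (sig j \<epsilon> W) W (chi j \<epsilon> W)" .
    then show thesis using s j
      by (intro jump) (auto simp: m1_def m2_def celerity_min_def celerity_max_def admissible_jump_def lax_shock_def)
  next
    case c
    then have "\<not> genuinely_nonlinear Om lam R j" using not_genuinely_nonlinear_and_degenerate W by blast
    then show thesis using c j contact_along_degenerate_curve[OF F hyp j wc W c seg]
      by (intro jump) (auto simp: m1_def m2_def celerity_min_def celerity_max_def admissible_jump_def)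
  qed
qed

definition smooth_piece where
  "smooth_piece Om lam R U I \<longleftrightarrow> U constant_on I \<or>
     (\<exists>j\<in>{1..CARD('m)}. genuinely_nonlinear Om lam R j \<and>
        (\<forall>\<xi>\<in>I. lam j (U \<xi>) = \<xi> \<and> (U has_vector_derivative R j (U \<xi>)) (at \<xi>)))"
  for R :: "nat \<Rightarrow> real^'m \<Rightarrow> real^'m"

definition jumps_admissibly where
  "jumps_admissibly F Om lam R U s \<longleftrightarrow> (\<exists>a\<in>Om. \<exists>b\<in>Om.
     (U \<longlongrightarrow> a) (at_left s) \<and> (U \<longlongrightarrow> b) (at_right s) \<and> admissible_jump F Om lam R s a b)"
  for F :: "real^'m \<Rightarrow> real^'m"

text \<open>A version of \<open>composed_of_waves\<close> with the set \<open>S\<close> made explicit and with arbitrary connected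
  sets in place of the components of \<open>- S\<close>; unlike components, these survive when \<open>S\<close> is enlarged, as
  happens each time a wave is added.\<close>

definition wave_pattern where
  "wave_pattern F Om lam R U S \<longleftrightarrow> (\<forall>\<xi>. U \<xi> \<in> Om) \<and> finite S \<and>
     (\<forall>I. connected I \<and> I \<inter> S = {} \<longrightarrow> smooth_piece Om lam R U I) \<and>
     (\<forall>s\<in>S. jumps_admissibly F Om lam R U s)"
  for F :: "real^'m \<Rightarrow> real^'m"

lemma wave_pattern_imp_composed_of_waves:
  assumes "wave_pattern F Om lam R U S"
  shows "composed_of_waves F Om lam R U"
proof -
  have "smooth_piece Om lam R U I" if "I \<in> components (- S)" for I
    using assms in_components_connected[OF that] in_components_subset[OF that]
    unfolding wave_pattern_def by blast
  then show ?thesis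
    using assms unfolding composed_of_waves_def wave_pattern_def smooth_piece_def
      jumps_admissibly_def admissible_jump_def
    by (intro conjI exI[of _ S]) auto
qed

lemma smooth_piece_transform:
  assumes "smooth_piece Om lam R U I" "open N" "I \<subseteq> N" "\<And>\<xi>. \<xi> \<in> N \<Longrightarrow> U \<xi> = V \<xi>"
  shows "smooth_piece Om lam R V I"
proof -
  have eq: "V \<xi> = U \<xi>" if "\<xi> \<in> I" for \<xi> using assms that by auto
  have "(V has_vector_derivative v) (at \<xi>)" if "(U has_vector_derivative v) (at \<xi>)" "\<xi> \<in> I" for v \<xi>
    by (rule has_vector_derivative_transform_within_open[OF that(1) assms(2)]) (use assms that in auto)
  then show ?thesis
    using assms(1) eq unfolding smooth_piece_def constant_on_def by (auto simp: eq) 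
qed

lemma jumps_admissibly_transform:
  assumes "jumps_admissibly F Om lam R U s" "open N" "s \<in> N" "\<And>\<xi>. \<xi> \<in> N \<Longrightarrow> U \<xi> = V \<xi>"
  shows "jumps_admissibly F Om lam R V s"
proof -
  have "\<forall>\<^sub>F \<xi> in at s within A. U \<xi> = V \<xi>" for A
    using assms(2-4) by (auto simp: eventually_at_topological)
  then have "(U \<longlongrightarrow> a) (at s within A) \<longleftrightarrow> (V \<longlongrightarrow> a) (at s within A)" for a A
    by (rule tendsto_cong)
  then show ?thesis using assms(1) unfolding jumps_admissibly_def by simp
qed

lemma connected_avoiding_point:
  fixes I :: "real set"
  assumes "connected I" "m \<notin> I"
  shows "I \<subseteq> {..<m} \<or> I \<subseteq> {m<..}"
proof (rule ccontr)
  assume "\<not> ?thesis"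
  then obtain x y where "x \<in> I" "y \<in> I" "\<not> x < m" "\<not> m < y" by blast
  then have "m \<in> I" using connectedD_interval[OF assms(1), of y x m] by simp
  with assms(2) show False ..
qed

text \<open>Adding a wave to the right of a pattern. The new wave is faster than everything already present
  (\<open>S\<close> lies below \<open>m1\<close>), and the old pattern has reached its last state \<open>W\<close> before \<open>m1\<close>; so
  the two patterns fit together without interaction.\<close>

lemma append_wave:
  fixes F :: "real^'m \<Rightarrow> real^'m"
  assumes F: "\<And>W. W \<in> Om \<Longrightarrow> F differentiable at W"
    and hyp: "strictly_hyperbolic F Om lam R" and j: "j \<in> {1..CARD('m)}"
    and field: "genuinely_nonlinear Om lam R j \<or> linearly_degenerate Om lam R j"
    and wc: "wave_curve F Om lam R j Th (chi j) (sig j)" and W: "W \<in> Om"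
    and seg: "closed_segment 0 \<epsilon> \<subseteq> Th W"
    and m1: "m1 = celerity_min Om lam R sig j \<epsilon> W"
    and m2: "m2 = celerity_max Om lam R chi sig j \<epsilon> W"
    and pat: "wave_pattern F Om lam R U S"
    and S: "\<And>s. s \<in> S \<Longrightarrow> s < m1"
    and c: "c < m1" and U_left: "\<And>\<xi>. c < \<xi> \<Longrightarrow> \<xi> < m1 \<Longrightarrow> U \<xi> = W"
  defines "V \<equiv> (\<lambda>\<xi>. if \<xi> < m1 then U \<xi> else if \<xi> < m2 then chi j (\<xi> - m1) W else chi j \<epsilon> W)"
  shows "wave_pattern F Om lam R V (insert m1 (insert m2 S))"
proof -
  note D = wave_curveD[OF wc W]
  have \<epsilon>: "\<epsilon> \<in> Th W" using seg by auto
  note cases = simple_wave_cases[where chi = chi and sig = sig, OF F hyp j field wc W seg, folded m1 m2]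
  have m12: "m1 \<le> m2" by (rule cases) auto
  have mid: "\<xi> - m1 \<in> {0<..<\<epsilon>} \<and> \<xi> - m1 \<in> Th W \<and> genuinely_nonlinear Om lam R j \<and> lam j (chi j (\<xi> - m1) W) = \<xi>"
    if "m1 < \<xi>" "\<xi> < m2" for \<xi>
  proof (rule cases)
    assume *: "genuinely_nonlinear Om lam R j" "0 < \<epsilon>" "m2 = m1 + \<epsilon>"
      "\<And>e. e \<in> {0..\<epsilon>} \<Longrightarrow> lam j (chi j e W) = m1 + e"
    then show ?thesis using *(4)[of "\<xi> - m1"] seg that by (auto simp: closed_segment_eq_real_ivl)
  qed (use that in auto)
  have V_left: "V \<xi> = U \<xi>" if "\<xi> < m1" for \<xi> using that by (simp add: V_def)
  have V_mid: "V \<xi> = chi j (\<xi> - m1) W" if "m1 < \<xi>" "\<xi> < m2" for \<xi> using that by (simp add: V_def)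
  have V_right: "V \<xi> = chi j \<epsilon> W" if "m2 < \<xi>" for \<xi> using that m12 by (simp add: V_def)
  have V_in: "V \<xi> \<in> Om" for \<xi>
  proof (cases "m1 < \<xi> \<and> \<xi> < m2")
    case True
    then show ?thesis using D(3) mid V_mid by metis
  next
    case False
    moreover have "U \<xi> \<in> Om" using pat by (simp add: wave_pattern_def)
    ultimately show ?thesis using D(1,2) D(3)[OF \<epsilon>] W by (auto simp: V_def)
  qed
  have smooth: "smooth_piece Om lam R V I" if I: "connected I" "I \<inter> insert m1 (insert m2 S) = {}" for I
  proof -
    from I have "m1 \<notin> I" "m2 \<notin> I" by auto
    then consider "I \<subseteq> {..<m1}" | "I \<subseteq> {m1<..<m2}" | "I \<subseteq> {m2<..}"
      using connected_avoiding_point[OF I(1)] by (metis greaterThanLessThan_def inf.bounded_iff)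
    then show ?thesis
    proof cases
      case 1
      have "smooth_piece Om lam R U I" using pat I unfolding wave_pattern_def by blast
      then show ?thesis by (rule smooth_piece_transform[OF _ open_lessThan 1]) (simp add: V_left)
    next
      case 2
      have "lam j (V \<xi>) = \<xi> \<and> (V has_vector_derivative R j (V \<xi>)) (at \<xi>)" if xi: "\<xi> \<in> {m1<..<m2}" for \<xi>
      proof -
        have m: "\<xi> - m1 \<in> Th W" "0 < \<xi> - m1" "genuinely_nonlinear Om lam R j"
          "lam j (chi j (\<xi> - m1) W) = \<xi>" using mid[of \<xi>] xi by auto
        have "((\<lambda>e. chi j e W) has_vector_derivative R j (chi j (\<xi> - m1) W)) (at (\<xi> - m1))"
          using D(5) m by blast
        moreover have "((\<lambda>x. x - m1) has_vector_derivative 1) (at \<xi>)"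
          by (auto intro!: derivative_eq_intros)
        ultimately have "((\<lambda>x. chi j (x - m1) W) has_vector_derivative R j (chi j (\<xi> - m1) W)) (at \<xi>)"
          using vector_diff_chain_at[of "\<lambda>x. x - m1" 1 \<xi> "\<lambda>e. chi j e W"] by (simp add: o_def)
        then have "(V has_vector_derivative R j (chi j (\<xi> - m1) W)) (at \<xi>)"
          by (rule has_vector_derivative_transform_within_open[OF _ open_greaterThanLessThan xi])
             (simp add: V_mid)
        then show ?thesis using V_mid[of \<xi>] xi m(4) by simp
      qed
      moreover have "I = {} \<or> genuinely_nonlinear Om lam R j" using 2 mid by fastforce
      ultimately show ?thesis unfolding smooth_piece_def constant_on_def using 2 j by blast
    next
      case 3
      then have "V constant_on I" unfolding constant_on_def using V_right by blast
      then show ?thesis by (simp add: smooth_piece_def)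
    qed
  qed
  have left_limit: "(V \<longlongrightarrow> W) (at_left m1)"
  proof (rule tendsto_eventually)
    show "\<forall>\<^sub>F \<xi> in at_left m1. V \<xi> = W"
      using c by (intro eventually_at_leftI[of c]) (auto simp: V_left U_left)
  qed
  have right_limit: "(V \<longlongrightarrow> chi j \<epsilon> W) (at_right m2)"
    by (intro tendsto_eventually eventually_at_rightI[of m2 "m2 + 1"]) (auto simp: V_right)
  have jump: "jumps_admissibly F Om lam R V s" if s: "s \<in> insert m1 (insert m2 S)" for s
  proof (cases "s \<in> S")
    case True
    then have "jumps_admissibly F Om lam R U s" using pat by (simp add: wave_pattern_def)
    then show ?thesis
      by (rule jumps_admissibly_transform[OF _ open_lessThan, of _ _ _ _ _ _ m1])
         (use True S V_left in auto)
  next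
    case False
    then have s12: "s = m1 \<or> s = m2" using s by auto
    show ?thesis
    proof (rule cases)
      assume "m1 = m2" "admissible_jump F Om lam R m1 W (chi j \<epsilon> W)"
      then show ?thesis
        unfolding jumps_admissibly_def using s12 left_limit right_limit W D(3)[OF \<epsilon>] by metis
    next
      assume r: "0 < \<epsilon>" "m2 = m1 + \<epsilon>"
      have shift: "((\<lambda>\<xi>. chi j (\<xi> - m1) W) \<longlongrightarrow> chi j (x - m1) W) (at x within A)" if "x - m1 \<in> Th W" for x A
      proof -
        have "((\<lambda>\<xi>. \<xi> - m1) \<longlongrightarrow> x - m1) (at x within A)" by (intro tendsto_intros)
        then show ?thesis by (rule isCont_tendsto_compose[OF D(4)[OF that]])
      qed
      have "\<forall>\<^sub>F \<xi> in at_right m1. V \<xi> = chi j (\<xi> - m1) W"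
        using r by (intro eventually_at_rightI[of m1 m2]) (auto simp: V_mid)
      then have 1: "(V \<longlongrightarrow> W) (at_right m1)"
        using shift[of m1 "{m1<..}"] D(1,2) by (simp add: tendsto_cong)
      have "\<forall>\<^sub>F \<xi> in at_left m2. V \<xi> = chi j (\<xi> - m1) W"
        using r by (intro eventually_at_leftI[of m1]) (auto simp: V_mid)
      then have 2: "(V \<longlongrightarrow> chi j \<epsilon> W) (at_left m2)"
        using shift[of m2 "{..<m2}"] r \<epsilon> by (simp add: tendsto_cong)
      show ?thesis
        unfolding jumps_admissibly_def admissible_jump_def
        using s12 left_limit right_limit 1 2 W D(3)[OF \<epsilon>] by blast
    qed
  qed
  show ?thesis
    using pat V_in smooth jump unfolding wave_pattern_def by simp
qed

text \<open>By induction on the number of waves: the hypothesis \<open>order\<close> puts the waves one after another in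
  the variable \<open>\<xi>\<close>, so each can be appended to the previous ones.\<close>

theorem superposition_of_waves:
  fixes F :: "real^'m \<Rightarrow> real^'m" and \<epsilon> :: "nat \<Rightarrow> real" and W :: "nat \<Rightarrow> real^'m"
  assumes F: "\<And>W. W \<in> Om \<Longrightarrow> F differentiable at W"
    and hyp: "strictly_hyperbolic F Om lam R" and p: "p \<le> CARD('m)"
    and field: "\<And>j. j \<in> {1..p} \<Longrightarrow> genuinely_nonlinear Om lam R j \<or> linearly_degenerate Om lam R j"
    and wc: "\<And>j. j \<in> {1..p} \<Longrightarrow> wave_curve F Om lam R j (Th j) (chi j) (sig j)"
    and W: "\<And>j. j \<in> {0..p} \<Longrightarrow> W j \<in> Om"
    and seg: "\<And>j. j \<in> {1..p} \<Longrightarrow> closed_segment 0 (\<epsilon> j) \<subseteq> Th j (W (j - 1))"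
    and chain: "\<And>j. j \<in> {1..p} \<Longrightarrow> W j = chi j (\<epsilon> j) (W (j - 1))"
  defines "mum \<equiv> \<lambda>j. celerity_min Om lam R sig j (\<epsilon> j) (W (j - 1))"
    and "mup \<equiv> \<lambda>j. celerity_max Om lam R chi sig j (\<epsilon> j) (W (j - 1))"
  assumes order: "\<And>j. 1 \<le> j \<Longrightarrow> j < p \<Longrightarrow> mup j < mum (Suc j)"
  obtains U where "superposition p chi mum mup W U" "composed_of_waves F Om lam R U"
proof -
  have le: "mum j \<le> mup j" if j: "j \<in> {1..p}" for j
  proof -
    have "j \<in> {1..CARD('m)}" "W (j - 1) \<in> Om" using j p W by auto
    from simple_wave_cases[where chi = chi and sig = sig, OF F hyp this(1) field[OF j] wc[OF j] this(2) seg[OF j]]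
    show ?thesis unfolding mum_def mup_def by (metis dual_order.refl less_add_same_cancel1 less_imp_le)
  qed
  have mono: "mum (Suc i) \<le> mum (Suc k)" if "i \<le> k" "k < p" for i k
    using that
  proof (induction k rule: dec_induct)
    case (step n)
    then have "mum (Suc i) \<le> mum (Suc n)" by simp
    also have "\<dots> \<le> mup (Suc n)" using step by (intro le) simp
    also have "\<dots> \<le> mum (Suc (Suc n))" using order[of "Suc n"] step by simp
    finally show ?case .
  qed simp
  have "\<exists>U S. superposition k chi mum mup W U \<and> wave_pattern F Om lam R U S \<and>
      (\<forall>s\<in>S. 1 \<le> k \<and> s \<le> mup k)" if "k \<le> p" for k
    using that
  proof (induction k)
    case 0
    have "superposition 0 chi mum mup W (\<lambda>_. W 0)" by (simp add: superposition_def)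
    moreover have "wave_pattern F Om lam R (\<lambda>_. W 0) {}"
      using W[of 0] by (auto simp: wave_pattern_def smooth_piece_def constant_on_def)
    ultimately show ?case by blast
  next
    case (Suc k)
    then obtain U S where sup: "superposition k chi mum mup W U"
      and pat: "wave_pattern F Om lam R U S" and S: "\<And>s. s \<in> S \<Longrightarrow> 1 \<le> k \<and> s \<le> mup k"
      by (metis Suc_leD)
    define m1 where "m1 = mum (Suc k)"
    define m2 where "m2 = mup (Suc k)"
    \<comment> \<open>Beyond \<open>c\<close> the first \<open>k\<close> waves have passed; without any wave, any value below \<open>m1\<close> will do.\<close>
    define c where "c = (if k = 0 then m1 - 1 else mup k)"
    have Suck: "Suc k \<in> {1..p}" using Suc.prems by simp
    have m12: "m1 \<le> m2" using le[OF Suck] by (simp add: m1_def m2_def)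
    have mup_k: "mup k < m1" if "1 \<le> k" using order[OF that] Suc.prems by (simp add: m1_def)
    have c: "c < m1" using mup_k by (auto simp: c_def)
    have U_left: "U \<xi> = W k" if "c < \<xi>" for \<xi>
      using sup that by (auto simp: superposition_def c_def split: if_splits)
    define V where "V = (\<lambda>\<xi>. if \<xi> < m1 then U \<xi>
      else if \<xi> < m2 then chi (Suc k) (\<xi> - m1) (W k) else chi (Suc k) (\<epsilon> (Suc k)) (W k))"
    have "wave_pattern F Om lam R V (insert m1 (insert m2 S))"
      unfolding V_def
    proof (rule append_wave[where chi = chi and sig = sig, OF F hyp _ field[OF Suck] wc[OF Suck] _ _ _ _ pat _ c])
      show "closed_segment 0 (\<epsilon> (Suc k)) \<subseteq> Th (Suc k) (W k)" using seg[OF Suck] by simp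
      show "m1 = celerity_min Om lam R sig (Suc k) (\<epsilon> (Suc k)) (W k)" by (simp add: m1_def mum_def)
      show "m2 = celerity_max Om lam R chi sig (Suc k) (\<epsilon> (Suc k)) (W k)" by (simp add: m2_def mup_def)
      show "s < m1" if "s \<in> S" for s using S[OF that] mup_k by force
    qed (use Suck p W U_left in auto)
    moreover have "superposition (Suc k) chi mum mup W V"
      unfolding superposition_def
    proof (intro conjI ballI allI impI)
      fix j assume "j \<in> {1..Suc k}"
      then show "mum j \<le> mup j" using le Suc.prems by simp
    next
      fix j assume "1 \<le> j \<and> j < Suc k"
      then show "mup j < mum (Suc j)" using order Suc.prems by simp
    next
      fix j \<xi> assume j: "j \<in> {0..Suc k}" and xi: "(1 \<le> j \<longrightarrow> mup j < \<xi>) \<and> (j < Suc k \<longrightarrow> \<xi> < mum (Suc j))"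
      show "V \<xi> = W j"
      proof (cases "j = Suc k")
        case True
        then show ?thesis using xi m12 chain[OF Suck] by (simp add: V_def m2_def)
      next
        case False
        then have jk: "j \<le> k" using j by simp
        then have "\<xi> < m1" using xi mono[OF jk] Suc.prems by (force simp: m1_def)
        moreover have "U \<xi> = W j" using sup jk xi by (auto simp: superposition_def)
        ultimately show ?thesis by (simp add: V_def)
      qed
    next
      fix j \<xi> assume j: "j \<in> {1..Suc k}" and xi: "mum j < \<xi> \<and> \<xi> < mup j"
      show "V \<xi> = chi j (\<xi> - mum j) (W (j - 1))"
      proof (cases "j = Suc k")
        case True
        then show ?thesis using xi by (simp add: V_def m1_def m2_def)
      next
        case False
        then have jk: "1 \<le> j" "j \<le> k" using j by auto
        have "mup j < mum (Suc j)" using order jk Suc.prems by simp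
        also have "\<dots> \<le> m1" using mono[OF jk(2)] Suc.prems by (simp add: m1_def)
        finally have "\<xi> < m1" using xi by simp
        moreover have "U \<xi> = chi j (\<xi> - mum j) (W (j - 1))" using sup jk xi by (auto simp: superposition_def)
        ultimately show ?thesis by (simp add: V_def)
      qed
    qed
    moreover have "1 \<le> Suc k \<and> s \<le> mup (Suc k)" if "s \<in> insert m1 (insert m2 S)" for s
      using that S mup_k m12 by (fastforce simp: m2_def)
    ultimately show ?case by blast
  qed
  from this[of p] obtain U S where "superposition p chi mum mup W U" "wave_pattern F Om lam R U S"
    by blast
  then show thesis using wave_pattern_imp_composed_of_waves that by blast
qed

section \<open>Solving for the wave strengths\<close>

text \<open>An implicit function theorem reduced to existence: differentiability at a single point with
  injective partial derivative, and continuity nearby. The map \<open>(x, y) \<mapsto> (f (x, y), y)\<close> has an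
  invertible derivative at the base point, so by Sussmann's theorem it maps neighbourhoods of that
  point onto neighbourhoods of its image. The property \<open>P\<close> serves to keep the solution as
  close to the base point as one wishes.\<close>

lemma implicit_solution:
  fixes f :: "'a::euclidean_space \<times> 'b::euclidean_space \<Rightarrow> 'a"
  assumes cont: "\<forall>\<^sub>F z in nhds (x0, y0). isCont f z"
    and deriv: "(f has_derivative f') (at (x0, y0))"
    and inj: "\<And>x. f' (x, 0) = 0 \<Longrightarrow> x = 0"
    and P: "\<forall>\<^sub>F z in nhds (x0, y0). P z"
  shows "\<forall>\<^sub>F y in nhds y0. \<exists>x. P (x, y) \<and> f (x, y) = f (x0, y0)"
proof -
  obtain N where N: "open N" "(x0, y0) \<in> N" "\<And>z. z \<in> N \<Longrightarrow> isCont f z \<and> P z"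
    using eventually_conj[OF cont P] unfolding eventually_nhds by blast
  define g where "g z = (f z, snd z)" for z
  define g' where "g' z = (f' z, snd z)" for z
  have lin: "linear f'" using deriv by (rule has_derivative_linear)
  define A where "A x = f' (x, 0)" for x
  have linA: "linear A"
    unfolding A_def by (rule linear_compose[OF _ lin, of "\<lambda>x. (x, 0)", unfolded o_def]) (auto intro: linearI)
  have "inj A" using inj linear_injective_0[OF linA] by (simp add: A_def)
  then obtain B where B: "linear B" "A \<circ> B = id"
    using linear_surjective_right_inverse[OF linA] linear_injective_imp_surjective[OF linA] by blast
  have AB: "f' (B u, 0) = u" for u using B(2) by (simp add: A_def fun_eq_iff)
  have split: "f' (x, y) = f' (x, 0) + f' (0, y)" for x y
    using linear_add[OF lin, of "(x, 0)" "(0, y)"] by simp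
  have blin: "bounded_linear f'" "bounded_linear B"
    using lin B(1) by (simp_all add: linear_conv_bounded_linear)
  have "g (x0, y0) \<in> interior (g ` N)"
  proof (rule sussmann_open_mapping[where g' = "\<lambda>w. (B (fst w - f' (0, snd w)), snd w)", OF N(1) _ N(2)])
    show "continuous_on N g"
      unfolding g_def using N(3) by (intro continuous_intros continuous_at_imp_continuous_on) auto
    show "(g has_derivative g') (at (x0, y0))"
      unfolding g_def g'_def by (intro has_derivative_Pair deriv has_derivative_snd has_derivative_ident)
    show "bounded_linear (\<lambda>w. (B (fst w - f' (0, snd w)), snd w))"
      by (intro bounded_linear_Pair bounded_linear_compose[OF blin(2)] bounded_linear_sub
          bounded_linear_compose[OF blin(1)] bounded_linear_fst bounded_linear_snd bounded_linear_zero)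
    show "g' \<circ> (\<lambda>w. (B (fst w - f' (0, snd w)), snd w)) = id"
    proof
      fix w show "(g' \<circ> (\<lambda>w. (B (fst w - f' (0, snd w)), snd w))) w = id w"
        using split[of "B (fst w - f' (0, snd w))" "snd w"] AB by (simp add: g'_def)
    qed
  qed (use N interior_open in auto)
  then have "\<forall>\<^sub>F w in nhds (g (x0, y0)). w \<in> g ` N"
    unfolding eventually_nhds using interior_subset open_interior by blast
  moreover have "((\<lambda>y. (f (x0, y0), y)) \<longlongrightarrow> g (x0, y0)) (nhds y0)"
    unfolding g_def by (auto intro!: tendsto_intros filterlim_ident)
  ultimately have "\<forall>\<^sub>F y in nhds y0. (f (x0, y0), y) \<in> g ` N"
    unfolding filterlim_iff by blast
  then show ?thesis
  proof eventually_elim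
    case (elim y)
    then obtain x where "(x, y) \<in> N" "f (x, y) = f (x0, y0)" unfolding g_def by auto
    then show ?case using N(3) by blast
  qed
qed

lemma has_vector_derivative_quadratic_remainder:
  fixes c :: "real \<Rightarrow> 'b::real_normed_vector"
  assumes "\<forall>\<^sub>F \<epsilon> in at 0. norm (c \<epsilon> - (c 0 + \<epsilon> *\<^sub>R v)) \<le> C * \<epsilon>\<^sup>2"
  shows "(c has_vector_derivative v) (at 0)"
proof -
  have "((\<lambda>h. norm (c (0 + h) - c 0 - h *\<^sub>R v) / norm h) \<longlongrightarrow> 0) (at 0)"
  proof (rule tendsto_sandwich[OF _ _ tendsto_const])
    show "\<forall>\<^sub>F h in at 0. norm (c (0 + h) - c 0 - h *\<^sub>R v) / norm h \<le> C * \<bar>h\<bar>"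
      using assms eventually_neq_at_within[of 0]
    proof eventually_elim
      case (elim h)
      have "norm (c (0 + h) - c 0 - h *\<^sub>R v) \<le> C * \<bar>h\<bar> * \<bar>h\<bar>"
        using elim(1) by (simp add: algebra_simps power2_eq_square)
      then show ?case using elim(2) by (simp add: divide_le_eq)
    qed
    show "((\<lambda>h. C * \<bar>h\<bar>) \<longlongrightarrow> 0) (at (0::real))" by (auto intro!: tendsto_eq_intros)
  qed simp
  then show ?thesis
    unfolding has_vector_derivative_def has_derivative_at
    by (auto intro: bounded_linear_scaleR_left)
qed

text \<open>Joint derivative at strength 0: in the state it is the identity, because \<open>chi 0 W = W\<close>, and in
  the strength it is \<open>R j W\<close>, because of the quadratic remainder.\<close>

lemma wave_curve_derivative:
  fixes F :: "real^'m \<Rightarrow> real^'m"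
  assumes wc: "wave_curve F Om lam R j Th chi sig" and Om: "open Om" and W: "W \<in> Om"
  shows "((\<lambda>z. chi (fst z) (snd z)) has_derivative (\<lambda>h. snd h + fst h *\<^sub>R R j W)) (at (0, W))"
proof -
  define f where "f = (\<lambda>z. chi (fst z) (snd z))"
  have f_eq: "(\<lambda>(\<epsilon>, W). chi \<epsilon> W) = f" by (auto simp: f_def)
  have "(0, W) \<in> {(\<epsilon>, W). W \<in> Om \<and> \<epsilon> \<in> Th W}" using wave_curveD(1)[OF wc W] W by simp
  then obtain D where D: "(f has_derivative blinfun_apply D) (at (0, W))"
    using wc unfolding wave_curve_def C1_on_def f_eq by blast
  have "((\<lambda>V. (0, V)) has_derivative (\<lambda>v. (0, v))) (at W)" by (auto intro!: derivative_eq_intros)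
  from has_derivative_compose[OF this D]
  have "((\<lambda>V. V) has_derivative (\<lambda>v. blinfun_apply D (0, v))) (at W)"
    by (rule has_derivative_transform_within_open[OF _ Om W]) (use wave_curveD(2)[OF wc] in \<open>simp add: f_def\<close>)
  from has_derivative_unique[OF this has_derivative_ident]
  have D_snd: "blinfun_apply D (0, v) = v" for v by (metis)
  obtain C where C: "\<forall>\<^sub>F \<epsilon> in at 0. norm (chi \<epsilon> W - (W + \<epsilon> *\<^sub>R R j W)) \<le> C * \<epsilon>\<^sup>2"
    using wc W unfolding wave_curve_def by blast
  have 1: "((\<lambda>e. chi e W) has_vector_derivative R j W) (at 0)"
    by (rule has_vector_derivative_quadratic_remainder[where C = C]) (use C wave_curveD(2)[OF wc W] in simp)
  have "((\<lambda>e. (e, W)) has_derivative (\<lambda>h. (h, 0))) (at 0)" by (auto intro!: derivative_eq_intros)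
  from has_derivative_compose[OF this D]
  have "((\<lambda>e. chi e W) has_derivative (\<lambda>h. blinfun_apply D (h, 0))) (at 0)" by (simp add: f_def)
  from has_derivative_unique[OF this 1[unfolded has_vector_derivative_def]]
  have D_fst: "blinfun_apply D (h, 0) = h *\<^sub>R R j W" for h by metis
  have "blinfun_apply D = (\<lambda>h. snd h + fst h *\<^sub>R R j W)"
  proof
    fix h :: "real \<times> (real^'m)"
    have "h = (0, snd h) + (fst h, 0)" by (cases h) simp
    then show "blinfun_apply D h = snd h + fst h *\<^sub>R R j W"
      by (metis blinfun.add_right D_fst D_snd)
  qed
  with D show ?thesis by (simp add: f_def)
qed

lemma isCont_tendsto_nhds: "isCont f x \<Longrightarrow> (f \<longlongrightarrow> f x) (nhds x)"
  by (simp add: isCont_def tendsto_at_iff_tendsto_nhds)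

text \<open>The state reached after the first \<open>k\<close> waves. The strengths are stored as components
  of the vector \<open>fst z\<close>, numbered through \<open>ix\<close>, and \<open>snd z\<close> is the left state. Storing them in a
  vector of full length gives strengths and states the same dimension, as \<open>implicit_solution\<close>
  requires.\<close>

primrec wave_chain ::
  "(nat \<Rightarrow> real \<Rightarrow> real^'m \<Rightarrow> real^'m) \<Rightarrow> (nat \<Rightarrow> 'm) \<Rightarrow> nat \<Rightarrow> (real^'m) \<times> (real^'m) \<Rightarrow> real^'m" where
  "wave_chain chi ix 0 z = snd z"
| "wave_chain chi ix (Suc k) z = chi (Suc k) (fst z $ ix (Suc k)) (wave_chain chi ix k z)"

lemma wave_chain_at_base_state:
  fixes W0 :: "real^'m"
  assumes wc: "\<And>j. j \<in> {1..p} \<Longrightarrow> wave_curve F Om lam R j (Th j) (chi j) (sig j)"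
    and Om: "open Om" and W0: "W0 \<in> Om" and k: "k \<le> p"
  shows "wave_chain chi ix k (0, W0) = W0"
    and "(wave_chain chi ix k has_derivative (\<lambda>h. snd h + (\<Sum>j=1..k. (fst h $ ix j) *\<^sub>R R j W0))) (at (0, W0))"
    and "\<forall>\<^sub>F z in nhds (0, W0). isCont (wave_chain chi ix k) z"
proof -
  have "wave_chain chi ix k (0, W0) = W0 \<and>
    (wave_chain chi ix k has_derivative (\<lambda>h. snd h + (\<Sum>j=1..k. (fst h $ ix j) *\<^sub>R R j W0))) (at (0, W0)) \<and>
    (\<forall>\<^sub>F z in nhds (0, W0). isCont (wave_chain chi ix k) z)"
    using k
  proof (induction k)
    case 0
    have "wave_chain chi ix 0 = snd" by auto
    then show ?case by (auto intro!: derivative_eq_intros always_eventually isCont_snd)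
  next
    case (Suc k)
    let ?V = "wave_chain chi ix k" and ?j = "Suc k"
    let ?c = "\<lambda>z. chi ?j (fst z) (snd z)" and ?e = "\<lambda>z. (fst z $ ix ?j, ?V z)"
    let ?D = "{(\<epsilon>, W). W \<in> Om \<and> \<epsilon> \<in> Th ?j W}"
    have j: "?j \<in> {1..p}" using Suc.prems by simp
    note wcj = wc[OF j]
    have V: "?V (0, W0) = W0" and V': "(?V has_derivative (\<lambda>h. snd h + (\<Sum>j=1..k. (fst h $ ix j) *\<^sub>R R j W0))) (at (0, W0))"
      and V_cont: "\<forall>\<^sub>F z in nhds (0, W0). isCont ?V z" using Suc by auto
    have step: "wave_chain chi ix ?j = (\<lambda>z. ?c (?e z))" by auto
    have e0: "?e (0, W0) = (0, W0)" by (simp add: V)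
    have "((\<lambda>z. fst z $ ix ?j) has_derivative (\<lambda>h. fst h $ ix ?j)) (at (0, W0))"
      by (intro bounded_linear_imp_has_derivative bounded_linear_compose[OF bounded_linear_vec_nth bounded_linear_fst])
    from has_derivative_Pair[OF this V']
    have "(?e has_derivative (\<lambda>h. (fst h $ ix ?j, snd h + (\<Sum>j=1..k. (fst h $ ix j) *\<^sub>R R j W0)))) (at (0, W0))" .
    from has_derivative_compose[OF this, of ?c, unfolded e0, OF wave_curve_derivative[OF wcj Om W0]]
    have "((\<lambda>z. ?c (?e z)) has_derivative
        (\<lambda>h. snd h + (\<Sum>j=1..k. (fst h $ ix j) *\<^sub>R R j W0) + (fst h $ ix ?j) *\<^sub>R R ?j W0)) (at (0, W0))"
      by simp
    then have d: "(wave_chain chi ix ?j has_derivative (\<lambda>h. snd h + (\<Sum>j=1..?j. (fst h $ ix j) *\<^sub>R R j W0))) (at (0, W0))"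
      unfolding step by (simp add: add.assoc)
    have D_open: "open ?D" and c_cont: "isCont ?c z" if "z \<in> ?D" for z
      using wcj that has_derivative_continuous unfolding wave_curve_def C1_on_def case_prod_beta by blast+
    have D0: "(0, W0) \<in> ?D" using wave_curveD(1)[OF wcj W0] W0 by simp
    have "isCont ?V (0, W0)" using V' by (rule has_derivative_continuous)
    then have "isCont ?e (0, W0)" by (intro continuous_intros)
    then have "((\<lambda>z. ?e z) \<longlongrightarrow> (0, W0)) (nhds (0, W0))"
      using isCont_tendsto_nhds[of "(0, W0)" ?e] e0 by simp
    then have "\<forall>\<^sub>F z in nhds (0, W0). ?e z \<in> ?D"
      by (rule topological_tendstoD[OF _ D_open[OF D0] D0])
    then have "\<forall>\<^sub>F z in nhds (0, W0). isCont (wave_chain chi ix ?j) z"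
      using V_cont
    proof eventually_elim
      case (elim z)
      have "isCont ?e z" using elim(2) by (intro continuous_intros)
      then show ?case unfolding step using c_cont[OF elim(1)] by (rule isCont_o2)
    qed
    moreover have "wave_chain chi ix ?j (0, W0) = W0" using wave_curveD(2)[OF wcj W0] V by simp
    ultimately show ?case using d by blast
  qed
  then show "wave_chain chi ix k (0, W0) = W0"
    "(wave_chain chi ix k has_derivative (\<lambda>h. snd h + (\<Sum>j=1..k. (fst h $ ix j) *\<^sub>R R j W0))) (at (0, W0))"
    "\<forall>\<^sub>F z in nhds (0, W0). isCont (wave_chain chi ix k) z" by auto
qed

lemma basis_family_coefficients_zero:
  assumes "basis_family n B" "(\<Sum>j=1..n. c j *\<^sub>R B j) = 0" "j \<in> {1..n}"
  shows "c j = 0"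
proof -
  have inj: "inj_on B {1..n}" and ind: "independent (B ` {1..n})"
    using assms(1) by (auto simp: basis_family_def)
  define u where "u v = c (the_inv_into {1..n} B v)" for v
  have u: "u (B i) = c i" if "i \<in> {1..n}" for i
    using the_inv_into_f_f[OF inj that] by (simp add: u_def)
  have "(\<Sum>v\<in>B ` {1..n}. u v *\<^sub>R v) = (\<Sum>i=1..n. c i *\<^sub>R B i)"
    by (subst sum.reindex[OF inj]) (simp add: u)
  then have "u (B j) = 0"
    using independentD[OF ind, of "B ` {1..n}" u "B j"] assms(2,3) by simp
  then show ?thesis using u[OF assms(3)] by simp
qed

text \<open>The linear algebra behind transversality. If \<open>D\<close> maps a combination \<open>v\<close> of \<open>r 1, \<dots>, r p\<close> to a
  vector whose first \<open>p\<close> components vanish, then \<open>D v\<close> is a combination of the remaining axes, which are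
  the images of the \<open>xi k\<close>. So \<open>v\<close> lies in the spans of the two halves of a basis, which meet only in zero.\<close>

lemma transversal_injective:
  fixes D :: "real^'m \<Rightarrow> real^'m"
  assumes ix: "bij_betw ix {1..CARD('m)} UNIV" and p: "p \<le> CARD('m)"
    and D: "linear D" "inj D"
    and xi: "\<And>k. k \<in> {p+1..CARD('m)} \<Longrightarrow> D (xi k) = axis (ix k) 1"
    and basis: "basis_family CARD('m) (\<lambda>j. if j \<le> p then r j else xi j)"
    and e_tail: "\<And>k. k \<in> {p+1..CARD('m)} \<Longrightarrow> e $ ix k = 0"
    and tangent: "\<And>i. i \<in> {1..p} \<Longrightarrow> D (\<Sum>j=1..p. (e $ ix j) *\<^sub>R r j) $ ix i = 0"
  shows "e = 0"
proof -
  define v where "v = (\<Sum>j=1..p. (e $ ix j) *\<^sub>R r j)"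
  have parts: "{1..CARD('m)} = {1..p} \<union> {p+1..CARD('m)}" "{1..p} \<inter> {p+1..CARD('m)} = {}" using p by auto
  have "D v = (\<Sum>i\<in>UNIV. (D v $ i) *\<^sub>R axis i 1)"
    using basis_expansion[of "D v"] by (simp add: scalar_mult_eq_scaleR)
  also have "\<dots> = (\<Sum>k=1..CARD('m). (D v $ ix k) *\<^sub>R axis (ix k) 1)"
    by (rule sum.reindex_bij_betw[OF ix, symmetric])
  also have "\<dots> = (\<Sum>k=1..p. (D v $ ix k) *\<^sub>R axis (ix k) 1) + (\<Sum>k=p+1..CARD('m). (D v $ ix k) *\<^sub>R axis (ix k) 1)"
    unfolding parts(1) using parts(2) by (intro sum.union_disjoint) auto
  also have "\<dots> = (\<Sum>k=p+1..CARD('m). (D v $ ix k) *\<^sub>R D (xi k))"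
    using tangent xi by (simp add: v_def)
  also have "\<dots> = D (\<Sum>k=p+1..CARD('m). (D v $ ix k) *\<^sub>R xi k)"
    by (simp add: linear_sum[OF D(1)] linear_scale[OF D(1)])
  finally have v_eq: "v = (\<Sum>k=p+1..CARD('m). (D v $ ix k) *\<^sub>R xi k)"
    using D(2) by (simp add: inj_eq)
  define c where "c j = (if j \<le> p then e $ ix j else - (D v $ ix j))" for j
  have "(\<Sum>j=1..CARD('m). c j *\<^sub>R (if j \<le> p then r j else xi j))
      = (\<Sum>j=1..p. (e $ ix j) *\<^sub>R r j) + (\<Sum>k=p+1..CARD('m). - (D v $ ix k) *\<^sub>R xi k)"
    unfolding parts(1) using parts(2) by (subst sum.union_disjoint) (auto simp: c_def intro!: sum.cong arg_cong2[of _ _ _ _ plus])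
  also have "\<dots> = 0" using v_eq by (simp add: v_def sum_negf)
  finally have c0: "c j = 0" if "j \<in> {1..CARD('m)}" for j
    using basis_family_coefficients_zero[OF basis _ that] by blast
  have "e $ i = 0" for i
  proof -
    obtain j where j: "j \<in> {1..CARD('m)}" "i = ix j" using ix unfolding bij_betw_def by blast
    then show ?thesis using c0[OF j(1)] e_tail[of j] by (cases "j \<le> p") (auto simp: c_def)
  qed
  then show ?thesis by (simp add: vec_eq_iff)
qed

lemma diffeomorphism_derivative_inj:
  fixes \<Phi> :: "'a::real_normed_vector \<Rightarrow> 'b::real_normed_vector"
  assumes "open X" "bij_betw \<Phi> X Y" "C1_on \<Phi> X" "C1_on (inv_into X \<Phi>) Y" "x \<in> X"
  shows "inj (frechet_derivative \<Phi> (at x))"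
proof -
  have y: "\<Phi> x \<in> Y" using assms bij_betwE by blast
  obtain \<Phi>' where \<Phi>': "(\<Phi> has_derivative blinfun_apply \<Phi>') (at x)" using assms unfolding C1_on_def by blast
  obtain \<Psi>' where \<Psi>': "(inv_into X \<Phi> has_derivative blinfun_apply \<Psi>') (at (\<Phi> x))"
    using assms(4) y unfolding C1_on_def by blast
  have "((\<lambda>z. z) has_derivative (\<lambda>h. \<Psi>' (\<Phi>' h))) (at x)"
    by (rule has_derivative_transform_within_open[OF has_derivative_compose[OF \<Phi>' \<Psi>'] assms(1,5)])
       (use assms(2) bij_betw_inv_into_left in fastforce)
  from has_derivative_unique[OF this has_derivative_ident] have "\<Psi>' (\<Phi>' h) = h" for h by metis
  then have "inj (blinfun_apply \<Phi>')" by (metis injI)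
  then show ?thesis using frechet_derivative_at[OF \<Phi>'] by simp
qed

section \<open>The partial Riemann problem\<close>

text \<open>Both celerities of a simple wave lie between the characteristic speeds of its two states, for a
  shock by the Lax condition. Hence waves of neighbouring families are ordered as soon as all states
  are close to one base state.\<close>

lemma celerity_bounds:
  fixes F :: "real^'m \<Rightarrow> real^'m"
  assumes "\<And>W. W \<in> Om \<Longrightarrow> F differentiable at W"
    and "strictly_hyperbolic F Om lam R" and "j \<in> {1..CARD('m)}"
    and "genuinely_nonlinear Om lam R j \<or> linearly_degenerate Om lam R j"
    and "wave_curve F Om lam R j Th (chi j) (sig j)" and "W \<in> Om"
    and "closed_segment 0 \<epsilon> \<subseteq> Th W"
  shows "min (lam j W) (lam j (chi j \<epsilon> W)) \<le> celerity_min Om lam R sig j \<epsilon> W"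
    and "celerity_max Om lam R chi sig j \<epsilon> W \<le> max (lam j W) (lam j (chi j \<epsilon> W))"
  by (rule simple_wave_cases[where chi = chi and sig = sig, OF assms]; simp)+

lemma superposition_outer_states:
  assumes "superposition p chi mum mup W U"
  shows "\<xi> < - (\<bar>mum 1\<bar> + \<bar>mup p\<bar>) \<Longrightarrow> U \<xi> = W 0"
    and "\<bar>mum 1\<bar> + \<bar>mup p\<bar> < \<xi> \<Longrightarrow> U \<xi> = W p"
proof -
  have plateau: "U \<xi> = W j" if "j \<le> p" "1 \<le> j \<Longrightarrow> mup j < \<xi>" "j < p \<Longrightarrow> \<xi> < mum (Suc j)" for j \<xi>
    using assms that unfolding superposition_def by auto
  show "U \<xi> = W 0" if "\<xi> < - (\<bar>mum 1\<bar> + \<bar>mup p\<bar>)"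
    using that by (intro plateau) auto
  show "U \<xi> = W p" if "\<bar>mum 1\<bar> + \<bar>mup p\<bar> < \<xi>"
    using that by (intro plateau) auto
qed

theorem theorem2:
  fixes F :: "real^'m \<Rightarrow> real^'m"
    and \<Omega> \<Omega>0 \<Theta> :: "(real^'m) set"
    and lam :: "nat \<Rightarrow> real^'m \<Rightarrow> real"
    and R :: "nat \<Rightarrow> real^'m \<Rightarrow> real^'m"
    and Th :: "nat \<Rightarrow> real^'m \<Rightarrow> real set"
    and chi :: "nat \<Rightarrow> real \<Rightarrow> real^'m \<Rightarrow> real^'m"
    and sig :: "nat \<Rightarrow> real \<Rightarrow> real^'m \<Rightarrow> real"
    and ix :: "nat \<Rightarrow> 'm"
    and p :: nat
    and W0 :: "real^'m"
    and \<Phi> :: "real^'m \<Rightarrow> real^'m"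
    and xi :: "nat \<Rightarrow> real^'m"
  defines "M \<equiv> constraint_manifold ix p \<Omega>0 \<Phi>"
  assumes ix: "bij_betw ix {1..CARD('m)} UNIV"
    and cone: "convex_open_cone \<Omega>"
    and flux: "C2_on F \<Omega>"
    and hyperbolic: "strictly_hyperbolic F \<Omega> lam R"
    and fields: "\<And>j. j \<in> {1..CARD('m)} \<Longrightarrow>
          genuinely_nonlinear \<Omega> lam R j \<or> linearly_degenerate \<Omega> lam R j"
    and curves: "\<And>j. j \<in> {1..CARD('m)} \<Longrightarrow>
          wave_curve F \<Omega> lam R j (Th j) (chi j) (sig j)"
    and p: "p \<le> CARD('m)"
    and nbhd0: "open \<Omega>0" "W0 \<in> \<Omega>0" "\<Omega>0 \<subseteq> \<Omega>"
    and nbhd_Theta: "open \<Theta>" "0 \<in> \<Theta>"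
    and diffeo: "bij_betw \<Phi> \<Omega>0 \<Theta>" "C1_on \<Phi> \<Omega>0" "C1_on (inv_into \<Omega>0 \<Phi>) \<Theta>"
    and W0_in_M: "W0 \<in> M"
    and xi: "\<And>k. k \<in> {p+1..CARD('m)} \<Longrightarrow>
          frechet_derivative \<Phi> (at W0) (xi k) = axis (ix k) 1"
    and transversality: "basis_family CARD('m) (\<lambda>j. if j \<le> p then R j W0 else xi j)"
  shows "\<exists>\<Omega>1. open \<Omega>1 \<and> W0 \<in> \<Omega>1 \<and> \<Omega>1 \<subseteq> \<Omega>0 \<and>
    (\<forall>Wl\<in>\<Omega>1. \<exists>\<epsilon> W U.
       W 0 = Wl \<and>
       (\<forall>j\<in>{1..p}. closed_segment 0 (\<epsilon> j) \<subseteq> Th j (W (j - 1)) \<and>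
                    W j = chi j (\<epsilon> j) (W (j - 1))) \<and>
       (\<forall>j\<in>{0..p}. W j \<in> \<Omega>) \<and>
       W p \<in> M \<and>
       superposition p chi
         (\<lambda>j. celerity_min \<Omega> lam R sig j (\<epsilon> j) (W (j - 1)))
         (\<lambda>j. celerity_max \<Omega> lam R chi sig j (\<epsilon> j) (W (j - 1)))
         W U \<and>
       solves_partial_riemann F \<Omega> lam R Wl M U)"
proof -
  have Om: "open \<Omega>" using cone by (simp add: convex_open_cone_def)
  have W0: "W0 \<in> \<Omega>" using nbhd0 by blast
  have F: "F differentiable at V" if "V \<in> \<Omega>" for V using C2_on_differentiable[OF flux that] .
  have curves_p: "wave_curve F \<Omega> lam R j (Th j) (chi j) (sig j)" if "j \<in> {1..p}" for j
    using curves that p by auto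
  have chain_base: "wave_chain chi ix k (0, W0) = W0"
    and chain_deriv: "(wave_chain chi ix k has_derivative
      (\<lambda>h. snd h + (\<Sum>j=1..k. (fst h $ ix j) *\<^sub>R R j W0))) (at (0, W0))"
    and chain_cont: "\<forall>\<^sub>F z in nhds (0, W0). isCont (wave_chain chi ix k) z" if "k \<le> p" for k
    using wave_chain_at_base_state[where chi = chi and p = p, OF curves_p Om W0 that] by simp_all

  \<comment> \<open>The midpoint \<open>d j\<close> of two consecutive eigenvalues at \<open>W0\<close> separates the \<open>j\<close>-waves from the
    \<open>(j+1)\<close>-waves between states close to \<open>W0\<close>.\<close>
  define d where "d j = (lam j W0 + lam (Suc j) W0) / 2" for j
  have near_each: "\<forall>\<^sub>F z in nhds (0, W0). fst z \<in> Th j (snd z) \<and> snd z \<in> \<Omega>0 \<and>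
      (j < p \<longrightarrow> lam j (snd z) < d j) \<and> (1 < j \<longrightarrow> d (j - 1) < lam j (snd z))"
    if j: "j \<in> {1..p}" for j
  proof -
    have jm: "j \<in> {1..CARD('m)}" using j p by auto
    have "open {(\<epsilon>, W). W \<in> \<Omega> \<and> \<epsilon> \<in> Th j W}" using curves_p[OF j] by (simp add: wave_curve_def)
    moreover have "(0, W0) \<in> {(\<epsilon>, W). W \<in> \<Omega> \<and> \<epsilon> \<in> Th j W}"
      using wave_curveD(1)[OF curves_p[OF j] W0] W0 by simp
    ultimately have 1: "\<forall>\<^sub>F z in nhds (0, W0). z \<in> {(\<epsilon>, W). W \<in> \<Omega> \<and> \<epsilon> \<in> Th j W}"
      by (rule eventually_nhds_in_open)
    have snd_lim: "(snd \<longlongrightarrow> W0) (nhds (0::real, W0))"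
      using tendsto_snd[OF filterlim_ident[of "nhds (0::real, W0)"]] by simp
    have 2: "\<forall>\<^sub>F z in nhds (0::real, W0). snd z \<in> \<Omega>0"
      using topological_tendstoD[OF snd_lim nbhd0(1,2)] .
    have "lam j differentiable at W0"
      using fields[OF jm] W0 by (auto simp: genuinely_nonlinear_def linearly_degenerate_def)
    then have "isCont (lam j) W0" by (rule differentiable_imp_continuous_within)
    then have lam_lim: "((\<lambda>z. lam j (snd z)) \<longlongrightarrow> lam j W0) (nhds (0::real, W0))"
      by (rule isCont_tendsto_compose[OF _ snd_lim])
    have 3: "\<forall>\<^sub>F z in nhds (0::real, W0). j < p \<longrightarrow> lam j (snd z) < d j"
    proof (cases "j < p")
      case True
      then have "lam j W0 < lam (Suc j) W0"
        using hyperbolic W0 jm p unfolding strictly_hyperbolic_def by auto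
      then have "lam j W0 < d j" by (simp add: d_def)
      from order_tendstoD(2)[OF lam_lim this] show ?thesis by (auto elim: eventually_mono)
    qed simp
    have 4: "\<forall>\<^sub>F z in nhds (0::real, W0). 1 < j \<longrightarrow> d (j - 1) < lam j (snd z)"
    proof (cases "1 < j")
      case True
      then have "j - 1 \<in> {1..CARD('m)}" "j - 1 < j" using jm by auto
      then have "lam (j - 1) W0 < lam j W0"
        using hyperbolic W0 jm unfolding strictly_hyperbolic_def by blast
      then have "d (j - 1) < lam j W0" using True by (simp add: d_def)
      from order_tendstoD(1)[OF lam_lim this] show ?thesis by (auto elim: eventually_mono)
    qed simp
    show ?thesis using 1 2 3 4 by eventually_elim auto
  qed
  have "\<forall>\<^sub>F z in nhds (0, W0). \<forall>j\<in>{1..p}. fst z \<in> Th j (snd z) \<and> snd z \<in> \<Omega>0 \<and>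
      (j < p \<longrightarrow> lam j (snd z) < d j) \<and> (1 < j \<longrightarrow> d (j - 1) < lam j (snd z))"
    by (intro eventually_ball_finite ballI near_each) auto
  then obtain N where N: "open N" "(0, W0) \<in> N" and
    N_near: "\<forall>z\<in>N. \<forall>j\<in>{1..p}. fst z \<in> Th j (snd z) \<and> snd z \<in> \<Omega>0 \<and>
      (j < p \<longrightarrow> lam j (snd z) < d j) \<and> (1 < j \<longrightarrow> d (j - 1) < lam j (snd z))"
    unfolding eventually_nhds by (elim exE conjE) (rule that)
  \<comment> \<open>A product neighbourhood, with a ball as first factor, contains with each strength the whole
    segment joining it to 0.\<close>
  obtain A B where AB: "open A" "open B" "0 \<in> A" "W0 \<in> B" "A \<times> B \<subseteq> N"
    by (rule open_prod_elim[OF N]) auto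
  obtain r where r: "0 < r" "ball 0 r \<subseteq> A" using AB(1,3) open_contains_ball by metis
  have near: "e \<in> Th j V \<and> V \<in> \<Omega>0 \<and> (j < p \<longrightarrow> lam j V < d j) \<and> (1 < j \<longrightarrow> d (j - 1) < lam j V)"
    if "\<bar>e\<bar> < r" "V \<in> B" "j \<in> {1..p}" for e V j
  proof -
    have "(e, V) \<in> N" using that r(2) AB(5) by (auto simp: subset_eq)
    from bspec[OF N_near this] that(3) show ?thesis by simp
  qed

  \<comment> \<open>The \<open>p\<close> equations of the constraint manifold, completed by trivial equations for the components of
    the strength vector that belong to no wave, so that \<open>f\<close> takes its values in the whole space.\<close>
  define I where "I = ix ` {1..p}"
  define f where "f z = (\<chi> i. if i \<in> I then \<Phi> (wave_chain chi ix p z) $ i else fst z $ i)" for z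
  define D where "D = frechet_derivative \<Phi> (at W0)"
  have \<Phi>_diff: "\<Phi> differentiable at V" if "V \<in> \<Omega>0" for V
    using diffeo(2) that unfolding C1_on_def differentiable_def by blast
  have D: "(\<Phi> has_derivative D) (at W0)"
    using \<Phi>_diff[OF nbhd0(2)] unfolding D_def by (simp add: frechet_derivative_works)
  define f' where "f' h = (\<chi> i. if i \<in> I then D (snd h + (\<Sum>j=1..p. (fst h $ ix j) *\<^sub>R R j W0)) $ i else fst h $ i)" for h
  have Phi0: "\<Phi> W0 $ i = 0" if "i \<in> I" for i
    using W0_in_M that by (auto simp: M_def constraint_manifold_def I_def)
  have f0: "f (0, W0) = 0"
    unfolding f_def chain_base[OF order_refl] using Phi0 by (simp add: vec_eq_iff)
  have f_deriv: "(f has_derivative f') (at (0, W0))"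
  proof -
    define P1 where "P1 y = (\<chi> i. if i \<in> I then y $ i else 0)" for y :: "real^'m"
    define P2 where "P2 y = (\<chi> i. if i \<in> I then 0 else y $ i)" for y :: "real^'m"
    have P1: "bounded_linear P1" and P2: "bounded_linear P2"
      unfolding linear_conv_bounded_linear[symmetric] P1_def P2_def
      by (auto intro!: linearI simp: vec_eq_iff)
    let ?V' = "\<lambda>h. snd h + (\<Sum>j=1..p. (fst h $ ix j) *\<^sub>R R j W0)"
    have "((\<lambda>z. \<Phi> (wave_chain chi ix p z)) has_derivative (\<lambda>h. D (?V' h))) (at (0, W0))"
      using has_derivative_compose[OF chain_deriv[OF order_refl], of \<Phi> D] D chain_base[OF order_refl] by simp
    moreover have "(fst has_derivative fst) (at (0, W0))" by (intro has_derivative_fst has_derivative_ident)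
    ultimately have "((\<lambda>z. P1 (\<Phi> (wave_chain chi ix p z)) + P2 (fst z)) has_derivative
        (\<lambda>h. P1 (D (?V' h)) + P2 (fst h))) (at (0, W0))"
      by (intro has_derivative_add bounded_linear.has_derivative[OF P1] bounded_linear.has_derivative[OF P2])
    moreover have "f = (\<lambda>z. P1 (\<Phi> (wave_chain chi ix p z)) + P2 (fst z))"
      "f' = (\<lambda>h. P1 (D (?V' h)) + P2 (fst h))"
      by (auto simp: fun_eq_iff f_def f'_def P1_def P2_def vec_eq_iff)
    ultimately show ?thesis by simp
  qed
  have f_cont: "\<forall>\<^sub>F z in nhds (0, W0). isCont f z"
  proof -
    have "isCont (wave_chain chi ix p) (0, W0)" using chain_deriv[OF order_refl] by (auto intro: has_derivative_continuous)
    then have "(wave_chain chi ix p \<longlongrightarrow> W0) (nhds (0, W0))"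
      using isCont_tendsto_nhds chain_base[OF order_refl] by metis
    from topological_tendstoD[OF this nbhd0(1,2)] chain_cont[OF order_refl] show ?thesis
    proof eventually_elim
      case (elim z)
      have "isCont \<Phi> (wave_chain chi ix p z)"
        using \<Phi>_diff[OF elim(1)] by (rule differentiable_imp_continuous_within)
      then have "isCont (\<lambda>z. \<Phi> (wave_chain chi ix p z)) z" by (rule isCont_o2[OF elim(2)])
      then show ?case unfolding f_def isCont_def
        by (intro vec_tendstoI) (auto intro!: tendsto_vec_nth tendsto_fst)
    qed
  qed
  have f'_inj: "e = 0" if e0: "f' (e, 0) = 0" for e
  proof (rule transversal_injective[OF ix p _ _ _ transversality])
    show "linear D" using D by (rule has_derivative_linear)
    show "inj D" unfolding D_def using diffeomorphism_derivative_inj[OF nbhd0(1) diffeo nbhd0(2)] .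
    show "D (xi k) = axis (ix k) 1" if "k \<in> {p+1..CARD('m)}" for k using xi[OF that] by (simp add: D_def)
    show "e $ ix k = 0" if k: "k \<in> {p+1..CARD('m)}" for k
    proof -
      have "ix k \<notin> I"
        unfolding I_def using inj_on_image_mem_iff[OF bij_betw_imp_inj_on[OF ix], of k "{1..p}"] k p by simp
      then show ?thesis using arg_cong[OF e0, of "\<lambda>v. v $ ix k"] by (simp add: f'_def)
    qed
    show "D (\<Sum>j=1..p. (e $ ix j) *\<^sub>R R j W0) $ ix i = 0" if "i \<in> {1..p}" for i
      using arg_cong[OF e0, of "\<lambda>v. v $ ix i"] that by (simp add: f'_def I_def)
  qed
  \<comment> \<open>What the solution of \<open>f = 0\<close> has to satisfy besides: strengths in the domains of the wave curves,
    and states close enough to \<open>W0\<close> for the waves to be ordered.\<close>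
  have P: "\<forall>\<^sub>F z in nhds (0, W0). (\<forall>j\<in>{1..p}. \<bar>fst z $ ix j\<bar> < r) \<and> (\<forall>k\<in>{0..p}. wave_chain chi ix k z \<in> B \<inter> \<Omega>0)"
  proof -
    have "\<forall>\<^sub>F z in nhds (0, W0). \<bar>fst z $ ix j\<bar> < r" for j
    proof -
      have "((\<lambda>z. \<bar>fst z $ ix j\<bar>) \<longlongrightarrow> \<bar>fst (0::real^'m, W0) $ ix j\<bar>) (nhds (0, W0))"
        by (intro tendsto_intros filterlim_ident)
      from order_tendstoD(2)[OF this, of r] r show ?thesis by simp
    qed
    moreover have "\<forall>\<^sub>F z in nhds (0, W0). wave_chain chi ix k z \<in> B \<inter> \<Omega>0" if "k \<in> {0..p}" for k
    proof -
      have k: "k \<le> p" using that by simp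
      have "isCont (wave_chain chi ix k) (0, W0)"
        using chain_deriv[OF k] by (rule has_derivative_continuous)
      then have "(wave_chain chi ix k \<longlongrightarrow> W0) (nhds (0, W0))"
        using isCont_tendsto_nhds chain_base[OF k] by metis
      from topological_tendstoD[OF this, of "B \<inter> \<Omega>0"] AB nbhd0 show ?thesis by (simp add: open_Int)
    qed
    ultimately show ?thesis by (intro eventually_conj eventually_ball_finite ballI) auto
  qed
  have "\<forall>\<^sub>F Wl in nhds W0. Wl \<in> \<Omega>0 \<and> (\<exists>e. ((\<forall>j\<in>{1..p}. \<bar>fst (e, Wl) $ ix j\<bar> < r) \<and>
     (\<forall>k\<in>{0..p}. wave_chain chi ix k (e, Wl) \<in> B \<inter> \<Omega>0)) \<and> f (e, Wl) = f (0, W0))"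
    using eventually_nhds_in_open[OF nbhd0(1,2)] implicit_solution[OF f_cont f_deriv f'_inj P]
    by (rule eventually_conj)
  then obtain \<Omega>1 where \<Omega>1: "open \<Omega>1" "W0 \<in> \<Omega>1" "\<Omega>1 \<subseteq> \<Omega>0"
    and sol: "\<And>Wl. Wl \<in> \<Omega>1 \<Longrightarrow> \<exists>e. (\<forall>j\<in>{1..p}. \<bar>e $ ix j\<bar> < r) \<and>
     (\<forall>k\<in>{0..p}. wave_chain chi ix k (e, Wl) \<in> B \<inter> \<Omega>0) \<and> f (e, Wl) = 0"
    unfolding eventually_nhds f0 by auto
  show ?thesis
  proof (intro exI[of _ \<Omega>1] conjI ballI \<Omega>1)
    fix Wl assume Wl: "Wl \<in> \<Omega>1"
    obtain e where small: "\<forall>j\<in>{1..p}. \<bar>e $ ix j\<bar> < r"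
      and states: "\<forall>k\<in>{0..p}. wave_chain chi ix k (e, Wl) \<in> B \<inter> \<Omega>0"
      and fe: "f (e, Wl) = 0" using sol[OF Wl] by (elim exE conjE) (rule that)
    define \<epsilon> where "\<epsilon> j = e $ ix j" for j
    define W where "W k = wave_chain chi ix k (e, Wl)" for k
    have W_in: "W k \<in> B" "W k \<in> \<Omega>0" "W k \<in> \<Omega>" if "k \<le> p" for k
      using bspec[OF states, of k] that nbhd0(3) by (auto simp: W_def)
    have chain: "W j = chi j (\<epsilon> j) (W (j - 1))" if "j \<in> {1..p}" for j
      using that by (cases j) (auto simp: W_def \<epsilon>_def)
    have seg: "closed_segment 0 (\<epsilon> j) \<subseteq> Th j (W (j - 1))" if j: "j \<in> {1..p}" for j
    proof
      fix x assume "x \<in> closed_segment 0 (\<epsilon> j)"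
      then have "\<bar>x\<bar> \<le> \<bar>\<epsilon> j\<bar>" by (auto simp: closed_segment_eq_real_ivl split: if_splits)
      then have "\<bar>x\<bar> < r" using bspec[OF small j] by (simp add: \<epsilon>_def)
      then show "x \<in> Th j (W (j - 1))" using near[of x "W (j - 1)" j] W_in(1)[of "j - 1"] j by auto
    qed
    let ?m = "\<lambda>j. celerity_min \<Omega> lam R sig j (\<epsilon> j) (W (j - 1))"
    let ?M = "\<lambda>j. celerity_max \<Omega> lam R chi sig j (\<epsilon> j) (W (j - 1))"
    have bounds: "(j < p \<longrightarrow> ?M j < d j) \<and> (1 < j \<longrightarrow> d (j - 1) < ?m j)" if j: "j \<in> {1..p}" for j
    proof -
      have jm: "j \<in> {1..CARD('m)}" and "W (j - 1) \<in> \<Omega>" using j p W_in by auto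
      note cb = celerity_bounds[where chi = chi and sig = sig, OF F hyperbolic jm fields[OF jm] curves[OF jm] this(2) seg[OF j],
          folded chain[OF j]]
      show ?thesis
        using cb near[of 0 "W (j - 1)" j] near[of 0 "W j" j] W_in(1)[of j] W_in(1)[of "j - 1"] r j
        by (auto simp: min_le_iff_disj le_max_iff_disj)
    qed
    have order: "?M j < ?m (Suc j)" if "1 \<le> j" "j < p" for j
      using bounds[of j] bounds[of "Suc j"] that by force
    obtain U where U: "superposition p chi ?m ?M W U" "composed_of_waves F \<Omega> lam R U"
    proof (rule superposition_of_waves[where W = W and \<epsilon> = \<epsilon>, OF F hyperbolic p _ curves_p _ seg chain])
      show "genuinely_nonlinear \<Omega> lam R j \<or> linearly_degenerate \<Omega> lam R j" if "j \<in> {1..p}" for j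
        using fields p that by auto
    qed (use W_in(3) order in auto)
    have "W p \<in> M"
      unfolding M_def constraint_manifold_def
    proof (intro CollectI conjI ballI)
      fix i assume "i \<in> {1..p}"
      then show "\<Phi> (W p) $ ix i = 0"
        using arg_cong[OF fe, of "\<lambda>v. v $ ix i"] by (simp add: f_def I_def W_def)
    qed (simp add: W_in)
    define L where "L = \<bar>?m 1\<bar> + \<bar>?M p\<bar>"
    have left: "U \<xi> = W 0" if "\<xi> < - L" for \<xi>
      using superposition_outer_states(1)[OF U(1)] that by (simp add: L_def)
  have right: "U \<xi> = W p" if "L < \<xi>" for \<xi>
      using superposition_outer_states(2)[OF U(1)] that by (simp add: L_def)
    have "entropy_solution F \<Omega> lam R (\<lambda>x. if x < 0 then W 0 else W p) U"
      using composed_of_waves_imp_entropy_solution[OF F hyperbolic U(2) left right] .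
    then have "solves_partial_riemann F \<Omega> lam R Wl M U"
      unfolding solves_partial_riemann_def using \<open>W p \<in> M\<close>
      by (intro exI[of _ "\<lambda>x. if x < 0 then W 0 else W p"]) (auto simp: W_def)
    then show "\<exists>\<epsilon> W U.
       W 0 = Wl \<and>
       (\<forall>j\<in>{1..p}. closed_segment 0 (\<epsilon> j) \<subseteq> Th j (W (j - 1)) \<and>
                    W j = chi j (\<epsilon> j) (W (j - 1))) \<and>
       (\<forall>j\<in>{0..p}. W j \<in> \<Omega>) \<and>
       W p \<in> M \<and>
       superposition p chi
         (\<lambda>j. celerity_min \<Omega> lam R sig j (\<epsilon> j) (W (j - 1)))
         (\<lambda>j. celerity_max \<Omega> lam R chi sig j (\<epsilon> j) (W (j - 1)))
         W U \<and>
       solves_partial_riemann F \<Omega> lam R Wl M U"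
      using seg chain W_in(3) \<open>W p \<in> M\<close> U(1)
      by (intro exI[of _ \<epsilon>] exI[of _ W] exI[of _ U]) (auto simp: W_def)
  qed
qed

end
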